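(* Let $X>0$ be a random variable with moments of Gamma type, with associated meromorphic function $F(s)$, and let $Y=\log X$. Let $\gamma=\sum_{j=1}^J|a_j|-\sum_{k=1}^K|a'_k|$ and let $\rho_\pm$ be as in the context. If $\gamma>0$, then $X$ and $Y$ are absolutely continuous, with continuous and infinitely differentiable density functions $f_X(x)$ on $(0,\infty)$ and $f_Y(y)$ on $(-\infty,\infty)$ given by $$f_X(x)=\frac1{2\pi\mathrm i}\int_{\sigma-\mathrm i\infty}^{\sigma+\mathrm i\infty}x^{-s-1}F(s)\,\mathrm ds,\qquad f_Y(y)=\frac1{2\pi\mathrm i}\int_{\sigma-\mathrm i\infty}^{\sigma+\mathrm i\infty}e^{-ys}F(s)\,\mathrm ds,$$ for any $\sigma\in(\rho_-,\rho_+)$.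
   Context: A positive random variable $X$ has moments of Gamma type if there exist integers $J,K\ge0$ and real constants $C$, $D>0$, $a_j\ne0$, $b_j$ ($1\le j\le J$), $a'_k\neq0$, $b'_k$ ($1\le k\le K$) such that $$\mathbb E\,X^s=F(s):=C D^s\,\frac{\prod_{j=1}^J\Gamma(a_js+b_j)}{\prod_{k=1}^K\Gamma(a'_ks+b'_k)}$$ for all real $s$ in some interval of positive length. $F$ is regarded as a meromorphic function on $\mathbb C$ (removable singularities removed); it has no pole at $0$. Let $\rho_+:=\min\{x>0:x\text{ is a pole of }F\}$ and $\rho_-:=\max\{x<0:x\text{ is a pole of }F\}$, with $\rho_+=\infty$, $\rho_-=-\infty$ if there is no such pole. (Then $\mathbb E X^s=F(s)$ for all $s$ with $\rho_-<\operatorname{Re}s<\rho_+$.) *)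

theory Defs
  imports "HOL-Probability.Probability" "HOL-Complex_Analysis.Complex_Analysis"
begin

text \<open>
  The library's \<open>Gamma\<close> takes the junk value 0 at its poles. Applying \<open>remove_sings\<close> to the literal
  quotient replaces its value at every point by the limit there, if that exists, so \<open>gamma_type_fun\<close>
  is the meromorphic function with removable singularities removed (and value 0 at the poles).
\<close>

definition gamma_type_fun ::
  "nat \<Rightarrow> nat \<Rightarrow> real \<Rightarrow> real \<Rightarrow> (nat \<Rightarrow> real) \<Rightarrow> (nat \<Rightarrow> real) \<Rightarrow> (nat \<Rightarrow> real) \<Rightarrow> (nat \<Rightarrow> real)
    \<Rightarrow> complex \<Rightarrow> complex" where
  "gamma_type_fun J K C D a b a' b' =
     remove_sings (\<lambda>s. of_real C * of_real D powr s *
       (\<Prod>j=1..J. Gamma (of_real (a j) * s + of_real (b j))) /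
       (\<Prod>k=1..K. Gamma (of_real (a' k) * s + of_real (b' k))))"

text \<open>
  Every interval of positive length contains a nonempty open one, so the latter suffices. A real pole
  of the meromorphic function cannot lie in the interval, since its value there is 0 while the
  moments of a positive random variable are positive.
\<close>

definition has_gamma_type_moments ::
  "'a measure \<Rightarrow> ('a \<Rightarrow> real) \<Rightarrow> nat \<Rightarrow> nat \<Rightarrow> real \<Rightarrow> real \<Rightarrow> (nat \<Rightarrow> real) \<Rightarrow> (nat \<Rightarrow> real) \<Rightarrow>
    (nat \<Rightarrow> real) \<Rightarrow> (nat \<Rightarrow> real) \<Rightarrow> bool" where
  "has_gamma_type_moments M X J K C D a b a' b' \<longleftrightarrow>
     D > 0 \<and> (\<forall>j\<in>{1..J}. a j \<noteq> 0) \<and> (\<forall>k\<in>{1..K}. a' k \<noteq> 0) \<and>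
     (\<exists>l u. l < u \<and> (\<forall>s\<in>{l<..<u}.
        integrable M (\<lambda>\<omega>. X \<omega> powr s) \<and>
        of_real (\<integral>\<omega>. X \<omega> powr s \<partial>M) = gamma_type_fun J K C D a b a' b' (of_real s)))"

text \<open>
  The poles of a meromorphic function are isolated, so the infimum and supremum below are attained
  whenever the set is nonempty; for the empty set they are \<open>\<infinity>\<close> and \<open>-\<infinity>\<close>.
\<close>

definition rho_plus :: "(complex \<Rightarrow> complex) \<Rightarrow> ereal" where
  "rho_plus F = Inf (ereal ` {x. 0 < x \<and> is_pole F (of_real x)})"

definition rho_minus :: "(complex \<Rightarrow> complex) \<Rightarrow> ereal" where
  "rho_minus F = Sup (ereal ` {x. x < 0 \<and> is_pole F (of_real x)})"

text \<open>
  The integral of \<open>g\<close> over the line from \<open>\<sigma> - \<i>\<infinity>\<close> to \<open>\<sigma> + \<i>\<infinity>\<close>, parametrised by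
  \<open>s = \<sigma> + \<i> t\<close>, \<open>ds = \<i> dt\<close>.
\<close>

definition vline_integrable :: "real \<Rightarrow> (complex \<Rightarrow> complex) \<Rightarrow> bool" where
  "vline_integrable \<sigma> g \<longleftrightarrow> integrable lborel (\<lambda>t. g (Complex \<sigma> t) * \<i>)"

definition vline_integral :: "real \<Rightarrow> (complex \<Rightarrow> complex) \<Rightarrow> complex" where
  "vline_integral \<sigma> g = (\<integral>t. g (Complex \<sigma> t) * \<i> \<partial>lborel)"

text \<open>Intended for open \<open>S\<close>, where the iterated \<open>deriv\<close> is the classical higher derivative.\<close>

definition infinitely_differentiable_on :: "(real \<Rightarrow> real) \<Rightarrow> real set \<Rightarrow> bool" where
  "infinitely_differentiable_on f S \<longleftrightarrow>
     (\<forall>n. \<forall>x\<in>S. ((deriv ^^ n) f) differentiable (at x))"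

end

theory Submission
  imports Defs
begin

text \<open>
  By the reflection formula \<open>|\<Gamma>(1/2 + iy)|\<^sup>2 = \<pi> / cosh (\<pi>y)\<close>, and \<open>|\<Gamma>(x + iy)| / \<Gamma>(x)\<close> increases
  with \<open>x > 0\<close>; with the functional equation this bounds \<open>|\<Gamma>|\<close> and \<open>1/|\<Gamma>|\<close> on vertical strips by
  \<open>exp ((\<epsilon> - \<pi>/2)|y|)\<close> and \<open>exp ((\<epsilon> + \<pi>/2)|y|)\<close> up to constants, without Stirling's formula. Hence \<open>F\<close>
  decays exponentially on vertical lines when \<open>\<gamma> > 0\<close>. On a line inside the interval where the moments
  are given, \<open>F(\<sigma> + it)\<close> is a multiple of the characteristic function of an exponentially tilted law
  of \<open>Y\<close>, so Fourier inversion yields the density of \<open>Y\<close>, as the restriction to the reals of a function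
  holomorphic near the real axis. The line may be moved to any \<open>\<sigma>\<close> between the poles \<open>\<rho>\<^sub>-\<close> and \<open>\<rho>\<^sub>+\<close>.
\<close>


text \<open>The obstacle is the position of the lines. The moments are given on an interval that
  need not contain 0, whereas \<open>rho_minus\<close> and \<open>rho_plus\<close> are measured from
  0, so poles of F between 0 and that interval have to be excluded. All poles are real, because
  Gamma (a s + b) with real a, b and a nonzero is singular only at real s. Off the real axis F can
  therefore be continued from the moment interval towards 0. It stays equal to the moment function
  there, and this is bounded, because moments of orders between 0 and a point of the interval exist.
  Bounded values near a point exclude a pole. As a result some line of the moment interval lies
  strictly between the poles: inversion is carried out on it, and all other lines are reached from
  it.\<close>

section \<open>Holomorphic dependence on a parameter and smooth traces on the real line\<close>

text \<open>Cauchy's inequality turns the local majorant of f into a majorant of its z-derivative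
  and so of the difference quotients; dominated convergence then yields the complex derivative of
  the integral.\<close>

lemma holomorphic_on_integral:
  fixes f :: "complex \<Rightarrow> 'a \<Rightarrow> complex"
  assumes "open S"
    and hol: "\<And>x. x \<in> space M \<Longrightarrow> (\<lambda>z. f z x) holomorphic_on S"
    and meas: "\<And>z. z \<in> S \<Longrightarrow> f z \<in> borel_measurable M"
    and dom: "\<And>z. z \<in> S \<Longrightarrow> \<exists>r>0. \<exists>g. integrable M g \<and>
                (\<forall>w\<in>ball z r. \<forall>x\<in>space M. cmod (f w x) \<le> g x)"
  shows "(\<lambda>z. \<integral>x. f z x \<partial>M) holomorphic_on S"
  unfolding holomorphic_on_open[OF \<open>open S\<close>]
proof
  fix z assume z: "z \<in> S"
  obtain r g where r: "r > 0" and g: "integrable M g"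
    and bd: "\<And>w x. w \<in> ball z r \<Longrightarrow> x \<in> space M \<Longrightarrow> cmod (f w x) \<le> g x"
    using dom[OF z] by blast
  obtain r2 where r2: "r2 > 0" "ball z r2 \<subseteq> S"
    using \<open>open S\<close> z open_contains_ball by blast
  \<comment> \<open>The factor 1/2 leaves room: closed discs of radius e / 2 around points of
    \<open>ball z e\<close> stay in \<open>ball z (2 * e)\<close>, where f is both holomorphic and
    bounded by g.\<close>
  define e where "e = min r r2 / 2"
  have e: "e > 0" "ball z (2 * e) \<subseteq> S" "ball z (2 * e) \<subseteq> ball z r"
    using r r2 by (auto simp: e_def)
  have der: "((\<lambda>w. f w x) has_field_derivative deriv (\<lambda>w. f w x) w) (at w)"
    if "w \<in> S" "x \<in> space M" for w x
    using hol[OF that(2)] \<open>open S\<close> that(1) by (meson holomorphic_derivI)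
  have dbound: "cmod (deriv (\<lambda>w. f w x) w) \<le> g x / (e / 2)" if w: "w \<in> ball z e" and x: "x \<in> space M" for w x
  proof -
    have sub: "cball w (e / 2) \<subseteq> ball z (2 * e)"
    proof
      fix v assume "v \<in> cball w (e / 2)"
      then have "dist z v \<le> dist z w + dist w v" "dist w v \<le> e / 2"
        by (auto simp: dist_triangle)
      then show "v \<in> ball z (2 * e)" using w e by auto
    qed
    have "cmod ((deriv ^^ 1) (\<lambda>w. f w x) w) \<le> fact 1 * g x / (e / 2) ^ 1"
    proof (rule Cauchy_inequality)
      show "(\<lambda>w. f w x) holomorphic_on ball w (e / 2)"
        by (rule holomorphic_on_subset[OF hol[OF x]]) (use sub e ball_subset_cball in blast)
      show "continuous_on (cball w (e / 2)) (\<lambda>w. f w x)"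
        by (rule continuous_on_subset[OF holomorphic_on_imp_continuous_on[OF hol[OF x]]]) (use sub e in blast)
      show "cmod (f v x) \<le> g x" if "cmod (w - v) = e / 2" for v
      proof -
        have "v \<in> cball w (e / 2)" using that by (simp add: dist_norm)
        then show ?thesis using bd x sub e by blast
      qed
    qed (use e in auto)
    then show ?thesis by simp
  qed
  have quot: "cmod ((f (z + h) x - f z x) / h) \<le> g x / (e / 2)"
    if h: "cmod h < e" "h \<noteq> 0" and x: "x \<in> space M" for h x
  proof -
    have "cmod (f (z + h) x - f z x) \<le> g x / (e / 2) * cmod (z + h - z)"
    proof (rule field_differentiable_bound)
      show "((\<lambda>w. f w x) has_field_derivative deriv (\<lambda>w. f w x) w) (at w within ball z e)"
        if "w \<in> ball z e" for w
        by (rule has_field_derivative_at_within[OF der]) (use that x e in auto)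
    qed (use dbound x h e in \<open>auto simp: dist_norm\<close>)
    then show ?thesis using h by (simp add: norm_divide field_simps)
  qed
  have integ: "integrable M (f w)" if "w \<in> ball z e" for w
  proof (rule Bochner_Integration.integrable_bound[OF g])
    have "w \<in> ball z (2 * e)" using that e by auto
    then have "w \<in> S" "w \<in> ball z r" using e by blast+
    then show "f w \<in> borel_measurable M" "AE x in M. cmod (f w x) \<le> norm (g x)"
      using meas bd by (auto intro!: AE_I2 order_trans[OF bd])
  qed
  define d where "d = (\<integral>x. deriv (\<lambda>w. f w x) z \<partial>M)"
  have "((\<lambda>z. \<integral>x. f z x \<partial>M) has_field_derivative d) (at z)"
    unfolding DERIV_def tendsto_at_iff_sequentially comp_def
  proof (intro allI impI)
    fix X :: "nat \<Rightarrow> complex"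
    assume X: "\<forall>i. X i \<in> UNIV - {0}" and lim: "X \<longlonglongrightarrow> 0"
    have "eventually (\<lambda>n. cmod (X n) < e) sequentially"
      using tendstoD[OF lim e(1)] by simp
    then obtain N where N: "\<And>n. n \<ge> N \<Longrightarrow> cmod (X n) < e"
      by (auto simp: eventually_sequentially)
    define Y where "Y n = X (n + N)" for n
    have Y: "cmod (Y n) < e" "Y n \<noteq> 0" for n using N X by (auto simp: Y_def)
    have limY: "Y \<longlonglongrightarrow> 0" unfolding Y_def by (rule LIMSEQ_ignore_initial_segment[OF lim])
    have zY: "z + Y n \<in> ball z e" for n using Y by (simp add: dist_norm)
    have mq: "(\<lambda>x. (f (z + Y n) x - f z x) / Y n) \<in> borel_measurable M" for n
      using integ[OF zY[of n]] integ[of z] e by auto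
    have limq: "(\<lambda>n. (f (z + Y n) x - f z x) / Y n) \<longlonglongrightarrow> deriv (\<lambda>w. f w x) z" if x: "x \<in> space M" for x
    proof -
      have "(\<lambda>h. (f (z + h) x - f z x) / h) \<midarrow>0\<rightarrow> deriv (\<lambda>w. f w x) z"
        using der[OF z x] unfolding DERIV_def .
      then show ?thesis using limY Y(2) unfolding tendsto_at_iff_sequentially comp_def by auto
    qed
    have "(\<lambda>n. \<integral>x. (f (z + Y n) x - f z x) / Y n \<partial>M) \<longlonglongrightarrow> d"
      unfolding d_def
    proof (rule integral_dominated_convergence[where w = "\<lambda>x. g x / (e / 2)"])
      \<comment> \<open>The derivative is a pointwise limit of measurable difference
        quotients.\<close>
      show "(\<lambda>x. deriv (\<lambda>w. f w x) z) \<in> borel_measurable M"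
        by (rule borel_measurable_LIMSEQ_metric[OF mq limq])
    qed (use g mq limq quot Y in \<open>auto\<close>)
    moreover have "(\<integral>x. (f (z + Y n) x - f z x) / Y n \<partial>M) =
        ((\<integral>x. f (z + Y n) x \<partial>M) - (\<integral>x. f z x \<partial>M)) / Y n" for n
      using integ[OF zY[of n]] integ[of z] e by (subst integral_divide_zero, subst Bochner_Integration.integral_diff) auto
    ultimately have "(\<lambda>n. ((\<integral>x. f (z + Y n) x \<partial>M) - (\<integral>x. f z x \<partial>M)) / Y n) \<longlonglongrightarrow> d" by (simp only:)
    then show "(\<lambda>n. ((\<integral>x. f (z + X n) x \<partial>M) - (\<integral>x. f z x \<partial>M)) / X n) \<longlonglongrightarrow> d"
      unfolding Y_def by (rule LIMSEQ_offset)
  qed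
  then show "\<exists>f'. ((\<lambda>z. \<integral>x. f z x \<partial>M) has_field_derivative f') (at z)" ..
qed

lemma Re_has_real_derivative_of_holomorphic:
  fixes G :: "complex \<Rightarrow> complex"
  assumes "(G has_field_derivative D) (at (of_real x))"
  shows "((\<lambda>x. Re (G (of_real x))) has_real_derivative Re D) (at x)"
proof -
  have "((\<lambda>x. G (of_real x)) has_vector_derivative D) (at x)"
    using assms by (rule has_vector_derivative_real_field)
  then have "((\<lambda>x. Re (G (of_real x))) has_vector_derivative Re D) (at x)"
    by (rule bounded_linear.has_vector_derivative[OF bounded_linear_Re])
  then show ?thesis by (simp add: has_real_derivative_iff_has_vector_derivative)
qed

text \<open>The n-th real derivative is the real part of the n-th complex derivative. The induction
  keeps this identity on all of the open set S, since an equality at a single point cannot be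
  differentiated.\<close>

lemma infinitely_differentiable_on_Re_holomorphic:
  fixes f :: "real \<Rightarrow> real" and S :: "real set"
  assumes "open U" "G holomorphic_on U" "open S" "of_real ` S \<subseteq> U"
    and f: "\<And>x. x \<in> S \<Longrightarrow> f x = Re (G (of_real x))"
  shows "infinitely_differentiable_on f S"
proof -
  have diff: "((deriv ^^ n) f has_real_derivative Re ((deriv ^^ Suc n) G (of_real x))) (at x)"
    if eq: "\<And>x. x \<in> S \<Longrightarrow> (deriv ^^ n) f x = Re ((deriv ^^ n) G (of_real x))" and x: "x \<in> S" for n x
  proof -
    have "(deriv ^^ n) G holomorphic_on U" using assms by (intro holomorphic_higher_deriv) auto
    then have "((deriv ^^ n) G has_field_derivative (deriv ^^ Suc n) G (of_real x)) (at (of_real x))"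
      using assms x by (auto intro!: holomorphic_derivI)
    from Re_has_real_derivative_of_holomorphic[OF this]
    show ?thesis
      by (rule has_field_derivative_transform_within_open[OF _ \<open>open S\<close> x]) (simp add: eq)
  qed
  have eq: "x \<in> S \<Longrightarrow> (deriv ^^ n) f x = Re ((deriv ^^ n) G (of_real x))" for n x
  proof (induction n arbitrary: x)
    case (Suc n)
    then have "deriv ((deriv ^^ n) f) x = Re ((deriv ^^ Suc n) G (of_real x))"
      by (intro DERIV_imp_deriv diff)
    then show ?case by simp
  qed (simp add: f)
  show ?thesis
    unfolding infinitely_differentiable_on_def
    using diff[OF eq] by (meson differentiableI has_field_derivative_imp_has_derivative)
qed


section \<open>Exponential bounds for Gamma and its reciprocal on vertical strips\<close>

text \<open>The arbitrary \<epsilon> absorbs the polynomial factors in |Im z| and makes the property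
  stable under shifts by 1: a shift costs nothing in one bound and a little \<epsilon> in the other.
  The condition on \<open>Im z\<close> keeps away from the poles and gives |z| \<ge> 1.\<close>

definition gamma_strip_bounded :: "real \<Rightarrow> real \<Rightarrow> bool" where
  "gamma_strip_bounded p q \<longleftrightarrow> (\<forall>\<epsilon>>0. \<exists>C. \<forall>z. p \<le> Re z \<and> Re z \<le> q \<and> 1 \<le> \<bar>Im z\<bar> \<longrightarrow>
     cmod (Gamma z) \<le> C * exp ((\<epsilon> - pi / 2) * \<bar>Im z\<bar>) \<and>
     cmod (rGamma z) \<le> C * exp ((\<epsilon> + pi / 2) * \<bar>Im z\<bar>))"

lemma divide_sqrt_sum_squares_mono:
  fixes x x' y :: real
  assumes "0 < x" "x \<le> x'"
  shows "x / sqrt (x\<^sup>2 + y\<^sup>2) \<le> x' / sqrt (x'\<^sup>2 + y\<^sup>2)"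
proof -
  have p: "sqrt (x\<^sup>2 + y\<^sup>2) > 0" "sqrt (x'\<^sup>2 + y\<^sup>2) > 0"
    using assms by (simp_all add: sum_power2_gt_zero_iff)
  have "x\<^sup>2 \<le> x'\<^sup>2" using assms by (intro power_mono) auto
  then have "x\<^sup>2 * y\<^sup>2 \<le> x'\<^sup>2 * y\<^sup>2" by (rule mult_right_mono) auto
  then have "(x * sqrt (x'\<^sup>2 + y\<^sup>2))\<^sup>2 \<le> (x' * sqrt (x\<^sup>2 + y\<^sup>2))\<^sup>2"
    by (simp add: power_mult_distrib algebra_simps)
  then have "x * sqrt (x'\<^sup>2 + y\<^sup>2) \<le> x' * sqrt (x\<^sup>2 + y\<^sup>2)"
    by (rule power2_le_imp_le) (use assms in auto)
  then show ?thesis using p by (simp add: field_simps)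
qed

text \<open>In Gauss's limit for Gamma the factorial and the modulus of the power of n cancel from
  the quotient, which leaves the factors (Re u + k) / |u + k|. Each is the cosine of the argument of
  u + k and increases when u moves right at fixed height.\<close>

lemma norm_Gamma_divide_Gamma_mono:
  fixes z w :: complex
  assumes "0 < Re z" "Re z \<le> Re w" "Im z = Im w"
  shows "cmod (Gamma z) / Gamma (Re z) \<le> cmod (Gamma w) / Gamma (Re w)"
proof -
  have series: "cmod (Gamma_series u n) / Gamma_series (Re u) n = (\<Prod>k=0..n. (Re u + k) / cmod (u + of_nat k))"
    if "Re u > 0" for u :: complex and n
  proof -
    have "cmod (Gamma_series u n) =
        fact n * exp (Re u * ln (of_nat n)) / cmod (pochhammer u (n + 1))"
      unfolding Gamma_series_def by (simp add: norm_divide norm_mult)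
    moreover have "cmod (pochhammer u (n + 1)) = (\<Prod>k=0..n. cmod (u + of_nat k))"
      by (simp add: pochhammer_prod prod_norm[symmetric] atLeast0_atMost_Suc atLeast0LessThan lessThan_Suc_atMost atLeast0AtMost)
    moreover have "pochhammer (Re u) (n + 1) = (\<Prod>k=0..n. Re u + real k)"
      by (simp add: pochhammer_prod atLeast0_atMost_Suc atLeast0LessThan lessThan_Suc_atMost atLeast0AtMost)
    ultimately show ?thesis
      by (simp add: Gamma_series_def prod_dividef)
  qed
  have lim: "(\<lambda>n. cmod (Gamma_series u n) / Gamma_series (Re u) n) \<longlonglongrightarrow> cmod (Gamma u) / Gamma (Re u)"
    if "Re u > 0" for u :: complex
    using that by (intro tendsto_divide tendsto_norm Gamma_series_LIMSEQ) (simp add: Gamma_real_pos less_imp_neq[THEN not_sym])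
  show ?thesis
  proof (rule LIMSEQ_le[OF lim lim])
    show "\<exists>N. \<forall>n\<ge>N. cmod (Gamma_series z n) / Gamma_series (Re z) n
        \<le> cmod (Gamma_series w n) / Gamma_series (Re w) n"
    proof (intro exI allI impI)
      fix n
      have "(Re z + real k) / cmod (z + of_nat k) \<le> (Re w + real k) / cmod (w + of_nat k)" for k :: nat
        using divide_sqrt_sum_squares_mono[of "Re z + real k" "Re w + real k" "Im z"] assms
        by (simp add: cmod_def)
      then have "(\<Prod>k=0..n. (Re z + k) / cmod (z + of_nat k)) \<le> (\<Prod>k=0..n. (Re w + k) / cmod (w + of_nat k))"
        using assms by (intro prod_mono) (auto intro!: divide_nonneg_nonneg add_nonneg_nonneg)
      then show "cmod (Gamma_series z n) / Gamma_series (Re z) n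
        \<le> cmod (Gamma_series w n) / Gamma_series (Re w) n"
        using series[of z n] series[of w n] assms by simp
    qed
  qed (use assms in auto)
qed

text \<open>On the line Re z = 1/2 the map z -> 1 - z is complex conjugation, so the reflection
  formula computes a squared modulus, and sin (pi z) becomes cos (i pi y).\<close>

lemma norm_Gamma_half_plus_imaginary:
  "(cmod (Gamma (1 / 2 + \<i> * of_real y)))\<^sup>2 = pi / cosh (pi * y)"
proof -
  let ?z = "1 / 2 + \<i> * complex_of_real y"
  have "1 - ?z = cnj ?z" by (simp add: complex_eq_iff)
  moreover have "Gamma (cnj ?z) = cnj (Gamma ?z)" by (rule cnj_Gamma[symmetric])
  ultimately have "Gamma ?z * cnj (Gamma ?z) = of_real pi / sin (of_real pi * ?z)"
    using Gamma_reflection_complex[of ?z] by simp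
  moreover have "sin (of_real pi * ?z) = of_real (cosh (pi * y))"
  proof -
    have "sin (of_real pi * ?z) = cos (\<i> * of_real (pi * y))"
      by (simp add: ring_distribs sin_add flip: of_real_divide cos_of_real sin_of_real)
        (simp add: sin_of_real cos_of_real mult_ac)
    also have "\<dots> = of_real (cosh (pi * y))"
      by (simp add: complex_eq_iff Re_cos Im_cos cosh_field_def)
    finally show ?thesis .
  qed
  ultimately have "complex_of_real ((cmod (Gamma ?z))\<^sup>2) = of_real (pi / cosh (pi * y))"
    by (simp only: complex_norm_square of_real_divide)
  then show ?thesis by (simp only: of_real_eq_iff)
qed

lemma gamma_strip_boundedI:
  assumes "\<And>\<epsilon>. \<epsilon> > 0 \<Longrightarrow> \<exists>C. \<forall>z. p \<le> Re z \<and> Re z \<le> q \<and> 1 \<le> \<bar>Im z\<bar> \<longrightarrow>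
             cmod (Gamma z) \<le> C * exp ((\<epsilon> - pi / 2) * \<bar>Im z\<bar>)"
    and "\<And>\<epsilon>. \<epsilon> > 0 \<Longrightarrow> \<exists>C. \<forall>z. p \<le> Re z \<and> Re z \<le> q \<and> 1 \<le> \<bar>Im z\<bar> \<longrightarrow>
             cmod (rGamma z) \<le> C * exp ((\<epsilon> + pi / 2) * \<bar>Im z\<bar>)"
  shows "gamma_strip_bounded p q"
  unfolding gamma_strip_bounded_def
proof (intro allI impI)
  fix \<epsilon> :: real assume "\<epsilon> > 0"
  from assms[OF this] obtain C1 C2 where
    C: "\<And>z. p \<le> Re z \<and> Re z \<le> q \<and> 1 \<le> \<bar>Im z\<bar> \<Longrightarrow> cmod (Gamma z) \<le> C1 * exp ((\<epsilon> - pi / 2) * \<bar>Im z\<bar>)"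
    "\<And>z. p \<le> Re z \<and> Re z \<le> q \<and> 1 \<le> \<bar>Im z\<bar> \<Longrightarrow> cmod (rGamma z) \<le> C2 * exp ((\<epsilon> + pi / 2) * \<bar>Im z\<bar>)"
    by blast
  have "C1 * exp t \<le> max C1 C2 * exp t" "C2 * exp t \<le> max C1 C2 * exp t" for t
    by (intro mult_right_mono; simp)+
  then show "\<exists>C. \<forall>z. p \<le> Re z \<and> Re z \<le> q \<and> 1 \<le> \<bar>Im z\<bar> \<longrightarrow>
     cmod (Gamma z) \<le> C * exp ((\<epsilon> - pi / 2) * \<bar>Im z\<bar>) \<and>
     cmod (rGamma z) \<le> C * exp ((\<epsilon> + pi / 2) * \<bar>Im z\<bar>)"
    by (intro exI[of _ "max C1 C2"]) (blast intro: order_trans C)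
qed

text \<open>Pays for the factor |z| from the functional equation: on a strip it costs only an
  arbitrarily small exponential rate \<delta>.\<close>

lemma norm_le_exp_Im:
  assumes "\<bar>Re z\<bar> \<le> R" "\<delta> > 0"
  shows "cmod z \<le> (R + 1 / \<delta>) * exp (\<delta> * \<bar>Im z\<bar>)"
proof -
  have "cmod z \<le> R + \<bar>Im z\<bar>" using cmod_le[of z] assms by linarith
  moreover have "R \<le> R * exp (\<delta> * \<bar>Im z\<bar>)" using assms mult_left_mono[of 1 "exp (\<delta> * \<bar>Im z\<bar>)" R] by simp
  moreover have "\<bar>Im z\<bar> \<le> (1 / \<delta>) * exp (\<delta> * \<bar>Im z\<bar>)"
  proof -
    have "\<delta> * \<bar>Im z\<bar> \<le> exp (\<delta> * \<bar>Im z\<bar>)"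
      using exp_ge_add_one_self[of "\<delta> * \<bar>Im z\<bar>"] by linarith
    then show ?thesis using assms by (simp add: field_simps)
  qed
  ultimately show ?thesis unfolding distrib_right by linarith
qed

lemma exp_mult_exp_eq:
  fixes p q r t :: real
  assumes "p + q = r"
  shows "C * exp (p * t) * (D * exp (q * t)) = C * D * exp (r * t)"
  unfolding assms[symmetric] by (simp add: distrib_right exp_add)

text \<open>Since Gamma (z + 1) = z Gamma z and |z| \<ge> 1, the modulus of Gamma does not grow in a
  step to the left. The reciprocal picks up a factor |z|, so its bound is taken with \<epsilon> / 2
  and the other half pays for |z|.\<close>

lemma gamma_strip_bounded_minus_1:
  assumes "gamma_strip_bounded p q"
  shows "gamma_strip_bounded (p - 1) (q - 1)"
proof (rule gamma_strip_boundedI)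
  fix \<epsilon> :: real assume \<epsilon>: "\<epsilon> > 0"
  have shift: "p \<le> Re (z + 1) \<and> Re (z + 1) \<le> q \<and> 1 \<le> \<bar>Im (z + 1)\<bar>"
    if "p - 1 \<le> Re z \<and> Re z \<le> q - 1 \<and> 1 \<le> \<bar>Im z\<bar>" for z using that by auto
  obtain C where C: "\<And>z. p \<le> Re z \<and> Re z \<le> q \<and> 1 \<le> \<bar>Im z\<bar> \<Longrightarrow> cmod (Gamma z) \<le> C * exp ((\<epsilon> - pi / 2) * \<bar>Im z\<bar>)"
    using assms \<epsilon> unfolding gamma_strip_bounded_def by blast
  have "cmod (Gamma z) \<le> C * exp ((\<epsilon> - pi / 2) * \<bar>Im z\<bar>)"
    if z: "p - 1 \<le> Re z \<and> Re z \<le> q - 1 \<and> 1 \<le> \<bar>Im z\<bar>" for z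
  proof -
    have "z \<noteq> 0" "1 \<le> cmod z" using z abs_Im_le_cmod[of z] by auto
    moreover have "z \<notin> \<int>\<^sub>\<le>\<^sub>0" using z by (auto elim!: nonpos_Ints_cases)
    then have "Gamma (z + 1) = z * Gamma z" by (rule Gamma_plus1)
    then have "cmod (Gamma (z + 1)) = cmod z * cmod (Gamma z)" by (simp add: norm_mult)
    ultimately have "cmod (Gamma z) \<le> cmod (Gamma (z + 1))"
      by (simp add: mult_le_cancel_right1)
    also have "\<dots> \<le> C * exp ((\<epsilon> - pi / 2) * \<bar>Im z\<bar>)" using C[OF shift[OF z]] by simp
    finally show ?thesis .
  qed
  then show "\<exists>C. \<forall>z. p - 1 \<le> Re z \<and> Re z \<le> q - 1 \<and> 1 \<le> \<bar>Im z\<bar> \<longrightarrow>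
             cmod (Gamma z) \<le> C * exp ((\<epsilon> - pi / 2) * \<bar>Im z\<bar>)" by blast
  obtain C where C: "\<And>z. p \<le> Re z \<and> Re z \<le> q \<and> 1 \<le> \<bar>Im z\<bar> \<Longrightarrow> cmod (rGamma z) \<le> C * exp ((\<epsilon> / 2 + pi / 2) * \<bar>Im z\<bar>)"
    using assms \<epsilon> unfolding gamma_strip_bounded_def by (meson half_gt_zero)
  define R where "R = \<bar>p - 1\<bar> + \<bar>q - 1\<bar>"
  have "cmod (rGamma z) \<le> (R + 1 / (\<epsilon> / 2)) * C * exp ((\<epsilon> + pi / 2) * \<bar>Im z\<bar>)"
    if z: "p - 1 \<le> Re z \<and> Re z \<le> q - 1 \<and> 1 \<le> \<bar>Im z\<bar>" for z
  proof -
    have "cmod (rGamma z) = cmod z * cmod (rGamma (z + 1))"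
      by (simp flip: norm_mult add: rGamma_plus1)
    also have "\<dots> \<le> ((R + 1 / (\<epsilon> / 2)) * exp (\<epsilon> / 2 * \<bar>Im z\<bar>)) * (C * exp ((\<epsilon> / 2 + pi / 2) * \<bar>Im z\<bar>))"
      using C[OF shift[OF z]] z \<epsilon>
      by (intro mult_mono norm_le_exp_Im) (auto simp: R_def)
    also have "\<dots> = (R + 1 / (\<epsilon> / 2)) * C * exp ((\<epsilon> + pi / 2) * \<bar>Im z\<bar>)"
      by (subst exp_mult_exp_eq[of "\<epsilon> / 2" "\<epsilon> / 2 + pi / 2" "\<epsilon> + pi / 2"])
       (simp_all add: mult_ac)
    finally show ?thesis .
  qed
  then show "\<exists>C. \<forall>z. p - 1 \<le> Re z \<and> Re z \<le> q - 1 \<and> 1 \<le> \<bar>Im z\<bar> \<longrightarrow>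
             cmod (rGamma z) \<le> C * exp ((\<epsilon> + pi / 2) * \<bar>Im z\<bar>)" by blast
qed

text \<open>The roles are exchanged: in a step to the right the reciprocal does not grow, and Gamma
  picks up the factor |z - 1|.\<close>

lemma gamma_strip_bounded_plus_1:
  assumes "gamma_strip_bounded p q"
  shows "gamma_strip_bounded (p + 1) (q + 1)"
proof (rule gamma_strip_boundedI)
  fix \<epsilon> :: real assume \<epsilon>: "\<epsilon> > 0"
  have shift: "p \<le> Re (z - 1) \<and> Re (z - 1) \<le> q \<and> 1 \<le> \<bar>Im (z - 1)\<bar>"
    if "p + 1 \<le> Re z \<and> Re z \<le> q + 1 \<and> 1 \<le> \<bar>Im z\<bar>" for z using that by auto
  obtain C where C: "\<And>z. p \<le> Re z \<and> Re z \<le> q \<and> 1 \<le> \<bar>Im z\<bar> \<Longrightarrow> cmod (rGamma z) \<le> C * exp ((\<epsilon> + pi / 2) * \<bar>Im z\<bar>)"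
    using assms \<epsilon> unfolding gamma_strip_bounded_def by blast
  have "cmod (rGamma z) \<le> C * exp ((\<epsilon> + pi / 2) * \<bar>Im z\<bar>)"
    if z: "p + 1 \<le> Re z \<and> Re z \<le> q + 1 \<and> 1 \<le> \<bar>Im z\<bar>" for z
  proof -
    have "1 \<le> cmod (z - 1)" using z abs_Im_le_cmod[of "z - 1"] by auto
    moreover have "cmod (rGamma (z - 1)) = cmod (z - 1) * cmod (rGamma z)"
      using rGamma_plus1[of "z - 1"] by (simp flip: norm_mult)
    ultimately have "cmod (rGamma z) \<le> cmod (rGamma (z - 1))"
      by (simp add: mult_le_cancel_right1)
    also have "\<dots> \<le> C * exp ((\<epsilon> + pi / 2) * \<bar>Im z\<bar>)" using C[OF shift[OF z]] by simp
    finally show ?thesis .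
  qed
  then show "\<exists>C. \<forall>z. p + 1 \<le> Re z \<and> Re z \<le> q + 1 \<and> 1 \<le> \<bar>Im z\<bar> \<longrightarrow>
             cmod (rGamma z) \<le> C * exp ((\<epsilon> + pi / 2) * \<bar>Im z\<bar>)" by blast
  obtain C where C: "\<And>z. p \<le> Re z \<and> Re z \<le> q \<and> 1 \<le> \<bar>Im z\<bar> \<Longrightarrow> cmod (Gamma z) \<le> C * exp ((\<epsilon> / 2 - pi / 2) * \<bar>Im z\<bar>)"
    using assms \<epsilon> unfolding gamma_strip_bounded_def by (meson half_gt_zero)
  define R where "R = \<bar>p\<bar> + \<bar>q\<bar>"
  have "cmod (Gamma z) \<le> (R + 1 / (\<epsilon> / 2)) * C * exp ((\<epsilon> - pi / 2) * \<bar>Im z\<bar>)"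
    if z: "p + 1 \<le> Re z \<and> Re z \<le> q + 1 \<and> 1 \<le> \<bar>Im z\<bar>" for z
  proof -
    have "z - 1 \<notin> \<int>\<^sub>\<le>\<^sub>0" using z by (auto elim!: nonpos_Ints_cases simp: complex_eq_iff)
    from Gamma_plus1[OF this] have "cmod (Gamma z) = cmod (z - 1) * cmod (Gamma (z - 1))"
      by (simp flip: norm_mult)
    also have "\<dots> \<le> ((R + 1 / (\<epsilon> / 2)) * exp (\<epsilon> / 2 * \<bar>Im (z - 1)\<bar>)) * (C * exp ((\<epsilon> / 2 - pi / 2) * \<bar>Im (z - 1)\<bar>))"
      using z \<epsilon>
      by (intro mult_mono norm_le_exp_Im C[OF shift[OF z]]) (auto simp: R_def)
    also have "\<dots> = (R + 1 / (\<epsilon> / 2)) * C * exp ((\<epsilon> - pi / 2) * \<bar>Im z\<bar>)"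
      by (subst exp_mult_exp_eq[of "\<epsilon> / 2" "\<epsilon> / 2 - pi / 2" "\<epsilon> - pi / 2"])
       (simp_all add: mult_ac)
    finally show ?thesis .
  qed
  then show "\<exists>C. \<forall>z. p + 1 \<le> Re z \<and> Re z \<le> q + 1 \<and> 1 \<le> \<bar>Im z\<bar> \<longrightarrow>
             cmod (Gamma z) \<le> C * exp ((\<epsilon> - pi / 2) * \<bar>Im z\<bar>)" by blast
qed

lemma gamma_strip_bounded_Un:
  assumes "gamma_strip_bounded p q" "gamma_strip_bounded p' q'" "p' \<le> q"
  shows "gamma_strip_bounded p q'"
  unfolding gamma_strip_bounded_def
proof (intro allI impI)
  fix \<epsilon> :: real assume "\<epsilon> > 0"
  obtain C1 where
    C1: "\<And>z. p \<le> Re z \<and> Re z \<le> q \<and> 1 \<le> \<bar>Im z\<bar> \<Longrightarrow> cmod (Gamma z) \<le> C1 * exp ((\<epsilon> - pi / 2) * \<bar>Im z\<bar>)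
      \<and> cmod (rGamma z) \<le> C1 * exp ((\<epsilon> + pi / 2) * \<bar>Im z\<bar>)"
    using assms(1)[unfolded gamma_strip_bounded_def, rule_format, OF \<open>\<epsilon> > 0\<close>] by blast
  obtain C2 where
    C2: "\<And>z. p' \<le> Re z \<and> Re z \<le> q' \<and> 1 \<le> \<bar>Im z\<bar> \<Longrightarrow> cmod (Gamma z) \<le> C2 * exp ((\<epsilon> - pi / 2) * \<bar>Im z\<bar>)
      \<and> cmod (rGamma z) \<le> C2 * exp ((\<epsilon> + pi / 2) * \<bar>Im z\<bar>)"
    using assms(2)[unfolded gamma_strip_bounded_def, rule_format, OF \<open>\<epsilon> > 0\<close>] by blast
  have "C1 * exp t \<le> max C1 C2 * exp t" "C2 * exp t \<le> max C1 C2 * exp t" for t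
    by (intro mult_right_mono; simp)+
  moreover have "(p \<le> Re z \<and> Re z \<le> q) \<or> (p' \<le> Re z \<and> Re z \<le> q')" if "p \<le> Re z" "Re z \<le> q'" for z
    using that \<open>p' \<le> q\<close> by linarith
  ultimately show "\<exists>C. \<forall>z. p \<le> Re z \<and> Re z \<le> q' \<and> 1 \<le> \<bar>Im z\<bar> \<longrightarrow>
     cmod (Gamma z) \<le> C * exp ((\<epsilon> - pi / 2) * \<bar>Im z\<bar>) \<and>
     cmod (rGamma z) \<le> C * exp ((\<epsilon> + pi / 2) * \<bar>Im z\<bar>)"
    by (intro exI[of _ "max C1 C2"]) (meson order_trans C1 C2)
qed

text \<open>By monotonicity |Gamma z| / Gamma (Re z) lies between its values on the two edges of the
  strip. On the left edge the reflection formula gives it exactly; the right edge is one functional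
  equation away. The real Gamma function is bounded and bounded away from 0 on the compact
  interval.\<close>

lemma gamma_strip_bounded_half: "gamma_strip_bounded (1 / 2) (3 / 2)"
proof -
  have "continuous_on {1/2..3/2} (Gamma :: real \<Rightarrow> real)"
    by (intro continuous_on_Gamma continuous_on_id) (auto elim!: nonpos_Ints_cases)
  note cont = this
  obtain x0 where x0: "x0 \<in> {1/2..3/2::real}" "\<And>x. x \<in> {1/2..3/2} \<Longrightarrow> Gamma x0 \<le> Gamma x"
    using continuous_attains_inf[OF compact_Icc _ cont] by auto
  obtain x1 where x1: "x1 \<in> {1/2..3/2::real}" "\<And>x. x \<in> {1/2..3/2} \<Longrightarrow> Gamma x \<le> Gamma x1"
    using continuous_attains_sup[OF compact_Icc _ cont] by auto
  note x = x0(1) x1(1) x0(2) x1(2)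
  have pos: "Gamma x0 > 0" using x by auto
  define h where "h y = cmod (Gamma (1 / 2 + \<i> * of_real y))" for y
  have h2: "(h y)\<^sup>2 = pi / cosh (pi * y)" for y unfolding h_def by (rule norm_Gamma_half_plus_imaginary)
  have e2: "(exp (- (pi / 2) * \<bar>y\<bar>))\<^sup>2 = exp (- (pi * \<bar>y\<bar>))" for y :: real
    by (simp add: power2_eq_square flip: exp_add)
  have ch: "exp (pi * \<bar>y\<bar>) / 2 \<le> cosh (pi * y)" "cosh (pi * y) \<le> exp (pi * \<bar>y\<bar>)" for y :: real
  proof -
    have c: "cosh (pi * y) = (exp (pi * \<bar>y\<bar>) + exp (- (pi * \<bar>y\<bar>))) / 2"
      using cosh_real_abs[of "pi * y"] by (simp add: cosh_field_def abs_mult)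
    have "exp (- (pi * \<bar>y\<bar>)) \<le> exp (pi * \<bar>y\<bar>)" "0 < exp (- (pi * \<bar>y\<bar>))" by simp_all
    moreover have "p / 2 \<le> (p + q) / 2 \<and> (p + q) / 2 \<le> p" if "q \<le> p" "0 < q" for p q :: real
      using that by simp
    ultimately show "exp (pi * \<bar>y\<bar>) / 2 \<le> cosh (pi * y)" "cosh (pi * y) \<le> exp (pi * \<bar>y\<bar>)"
      unfolding c by blast+
  qed
  have h_le: "h y \<le> sqrt (2 * pi) * exp (- (pi / 2) * \<bar>y\<bar>)" for y
  proof (rule power2_le_imp_le)
    show "(h y)\<^sup>2 \<le> (sqrt (2 * pi) * exp (- (pi / 2) * \<bar>y\<bar>))\<^sup>2"
      unfolding h2 power_mult_distrib e2 using ch(1)[of y] cosh_real_pos[of "pi * y"]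
      by (simp add: exp_minus field_simps)
  qed simp
  have h_ge: "sqrt pi * exp (- (pi / 2) * \<bar>y\<bar>) \<le> h y" for y
  proof (rule power2_le_imp_le)
    show "(sqrt pi * exp (- (pi / 2) * \<bar>y\<bar>))\<^sup>2 \<le> (h y)\<^sup>2"
      unfolding h2 power_mult_distrib e2 using ch(2)[of y] cosh_real_pos[of "pi * y"]
      by (simp add: exp_minus field_simps)
  qed (simp add: h_def)
  show ?thesis
  proof (rule gamma_strip_boundedI)
    fix \<epsilon> :: real assume \<epsilon>: "\<epsilon> > 0"
    \<comment> \<open>In the constant, 1 / 2 + 1 / \<epsilon> stems from the modulus of ?u = 1/2 + i
      Im z in the functional equation, and sqrt (2 pi) from cosh \<ge> exp / 2.\<close>
    have "cmod (Gamma z) \<le> (Gamma x1 / Gamma (3 / 2) * (1 / 2 + 1 / \<epsilon>) * sqrt (2 * pi)) * exp ((\<epsilon> - pi / 2) * \<bar>Im z\<bar>)"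
      if z: "1 / 2 \<le> Re z \<and> Re z \<le> 3 / 2 \<and> 1 \<le> \<bar>Im z\<bar>" for z
    proof -
      let ?u = "1 / 2 + \<i> * complex_of_real (Im z)"
      have "?u \<notin> \<int>\<^sub>\<le>\<^sub>0" using z by (auto elim!: nonpos_Ints_cases simp: complex_eq_iff)
      from Gamma_plus1[OF this] have "cmod (Gamma (?u + 1)) = cmod ?u * h (Im z)"
        by (simp add: norm_mult h_def)
      also have "\<dots> \<le> ((1 / 2 + 1 / \<epsilon>) * exp (\<epsilon> * \<bar>Im z\<bar>)) * (sqrt (2 * pi) * exp (- (pi / 2) * \<bar>Im z\<bar>))"
        using norm_le_exp_Im[of ?u "1/2" \<epsilon>] h_le[of "Im z"] \<epsilon>
        by (intro mult_mono) (auto simp: h_def)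
      also have "\<dots> = (1 / 2 + 1 / \<epsilon>) * sqrt (2 * pi) * exp ((\<epsilon> - pi / 2) * \<bar>Im z\<bar>)"
        by (subst exp_mult_exp_eq[of _ _ "\<epsilon> - pi / 2"]) simp_all
      finally have u: "cmod (Gamma (?u + 1)) \<le> \<dots>" .
      have "cmod (Gamma z) / Gamma (Re z) \<le> cmod (Gamma (?u + 1)) / Gamma (3 / 2)"
        using norm_Gamma_divide_Gamma_mono[of z "?u + 1"] z by simp
      moreover have "Gamma (Re z) > 0" using z by auto
      ultimately have "cmod (Gamma z) \<le> Gamma (Re z) / Gamma (3 / 2) * cmod (Gamma (?u + 1))"
        by (simp add: field_simps)
      also have "\<dots> \<le> Gamma x1 / Gamma (3 / 2) * ((1 / 2 + 1 / \<epsilon>) * sqrt (2 * pi) * exp ((\<epsilon> - pi / 2) * \<bar>Im z\<bar>))"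
        using x(4)[of "Re z"] x(2) z by (intro mult_mono u divide_right_mono) auto
      finally show ?thesis by (simp add: mult_ac)
    qed
    then show "\<exists>C. \<forall>z. 1 / 2 \<le> Re z \<and> Re z \<le> 3 / 2 \<and> 1 \<le> \<bar>Im z\<bar> \<longrightarrow>
             cmod (Gamma z) \<le> C * exp ((\<epsilon> - pi / 2) * \<bar>Im z\<bar>)" by blast
    have "cmod (rGamma z) \<le> (Gamma (1 / 2) / Gamma x0 / sqrt pi) * exp ((\<epsilon> + pi / 2) * \<bar>Im z\<bar>)"
      if z: "1 / 2 \<le> Re z \<and> Re z \<le> 3 / 2 \<and> 1 \<le> \<bar>Im z\<bar>" for z
    proof -
      let ?u = "1 / 2 + \<i> * complex_of_real (Im z)"
      have "h (Im z) / Gamma (1 / 2) \<le> cmod (Gamma z) / Gamma (Re z)"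
        using norm_Gamma_divide_Gamma_mono[of ?u z] z by (simp add: h_def)
      moreover have G: "Gamma (Re z) > 0" "Gamma (1 / 2 :: real) > 0" using z by auto
      ultimately have "Gamma (Re z) / Gamma (1 / 2) * h (Im z) \<le> cmod (Gamma z)"
        by (simp add: field_simps)
      moreover have "Gamma x0 / Gamma (1 / 2) * (sqrt pi * exp (- (pi / 2) * \<bar>Im z\<bar>)) \<le> Gamma (Re z) / Gamma (1 / 2) * h (Im z)"
        using x(3)[of "Re z"] z G pos by (intro mult_mono h_ge divide_right_mono) auto
      ultimately have low: "Gamma x0 / Gamma (1 / 2) * (sqrt pi * exp (- (pi / 2) * \<bar>Im z\<bar>)) \<le> cmod (Gamma z)"
        by linarith
      have "cmod (rGamma z) = inverse (cmod (Gamma z))"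
        by (simp add: Gamma_def norm_inverse)
      also have "\<dots> \<le> inverse (Gamma x0 / Gamma (1 / 2) * (sqrt pi * exp (- (pi / 2) * \<bar>Im z\<bar>)))"
        using pos G by (intro le_imp_inverse_le low) (auto intro!: mult_pos_pos divide_pos_pos)
      also have "\<dots> = Gamma (1 / 2) / Gamma x0 / sqrt pi * exp (pi / 2 * \<bar>Im z\<bar>)"
        by (simp add: exp_minus field_simps)
      also have "\<dots> \<le> Gamma (1 / 2) / Gamma x0 / sqrt pi * exp ((\<epsilon> + pi / 2) * \<bar>Im z\<bar>)"
        using \<epsilon> pos G by (intro mult_left_mono) (auto simp: distrib_right intro!: divide_nonneg_nonneg)
      finally show ?thesis .
    qed
    then show "\<exists>C. \<forall>z. 1 / 2 \<le> Re z \<and> Re z \<le> 3 / 2 \<and> 1 \<le> \<bar>Im z\<bar> \<longrightarrow>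
             cmod (rGamma z) \<le> C * exp ((\<epsilon> + pi / 2) * \<bar>Im z\<bar>)" by blast
  qed
qed

text \<open>The starting strip has width 1, just enough for a strip and its shifts by 1 to meet, so
  each induction step gains 1 on both sides.\<close>

lemma gamma_strip_bounded: "gamma_strip_bounded p q"
proof -
  have main: "gamma_strip_bounded (1 / 2 - real n) (3 / 2 + real n)" for n
  proof (induction n)
    case (Suc n)
    have "gamma_strip_bounded (1 / 2 - real n - 1) (3 / 2 + real n)"
      by (rule gamma_strip_bounded_Un[OF gamma_strip_bounded_minus_1[OF Suc] Suc]) auto
    then have "gamma_strip_bounded (1 / 2 - real n - 1) (3 / 2 + real n + 1)"
      by (rule gamma_strip_bounded_Un[OF _ gamma_strip_bounded_plus_1[OF Suc]]) auto
    then show ?case by (simp add: algebra_simps)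
  qed (use gamma_strip_bounded_half in simp)
  obtain n where "real n \<ge> \<bar>p\<bar> + \<bar>q\<bar>" using real_arch_simple by blast
  then have n: "1 / 2 - real (Suc n) \<le> p" "q \<le> 3 / 2 + real (Suc n)" by auto
  show ?thesis
    using main[of "Suc n"] n unfolding gamma_strip_bounded_def by (meson order_trans)
qed

text \<open>For real a and b the imaginary part of a s + b is a Im s. Hence the threshold 1 / |a|,
  and the use of \<epsilon> / |a| for Gamma so that the loss measured in \<open>Im s\<close> is
  \<epsilon>.\<close>

lemma Gamma_affine_strip_bound:
  assumes "a \<noteq> 0" "\<epsilon> > 0"
  obtains C where "\<And>s. \<bar>Re s\<bar> \<le> R \<Longrightarrow> 1 / \<bar>a\<bar> \<le> \<bar>Im s\<bar> \<Longrightarrow>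
      cmod (Gamma (of_real a * s + of_real b)) \<le> C * exp ((\<epsilon> - pi / 2 * \<bar>a\<bar>) * \<bar>Im s\<bar>)"
    "\<And>s. \<bar>Re s\<bar> \<le> R \<Longrightarrow> 1 / \<bar>a\<bar> \<le> \<bar>Im s\<bar> \<Longrightarrow>
      cmod (rGamma (of_real a * s + of_real b)) \<le> C * exp ((\<epsilon> + pi / 2 * \<bar>a\<bar>) * \<bar>Im s\<bar>)"
proof -
  have "\<epsilon> / \<bar>a\<bar> > 0" using assms by simp
  then obtain C where C: "\<And>z. b - \<bar>a\<bar> * R \<le> Re z \<and> Re z \<le> b + \<bar>a\<bar> * R \<and> 1 \<le> \<bar>Im z\<bar> \<Longrightarrow>
     cmod (Gamma z) \<le> C * exp ((\<epsilon> / \<bar>a\<bar> - pi / 2) * \<bar>Im z\<bar>) \<and>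
     cmod (rGamma z) \<le> C * exp ((\<epsilon> / \<bar>a\<bar> + pi / 2) * \<bar>Im z\<bar>)"
    using gamma_strip_bounded unfolding gamma_strip_bounded_def by meson
  have "cmod (Gamma (of_real a * s + of_real b)) \<le> C * exp ((\<epsilon> - pi / 2 * \<bar>a\<bar>) * \<bar>Im s\<bar>) \<and>
      cmod (rGamma (of_real a * s + of_real b)) \<le> C * exp ((\<epsilon> + pi / 2 * \<bar>a\<bar>) * \<bar>Im s\<bar>)"
    if s: "\<bar>Re s\<bar> \<le> R" "1 / \<bar>a\<bar> \<le> \<bar>Im s\<bar>" for s
  proof -
    let ?z = "of_real a * s + of_real b"
    have "\<bar>a * Re s\<bar> \<le> \<bar>a\<bar> * R" using s by (simp add: abs_mult mult_left_mono)
    then have "- (\<bar>a\<bar> * R) \<le> a * Re s" "a * Re s \<le> \<bar>a\<bar> * R" by linarith+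
    moreover have "1 \<le> \<bar>a\<bar> * \<bar>Im s\<bar>" using s assms by (simp add: field_simps)
    ultimately have "b - \<bar>a\<bar> * R \<le> Re ?z \<and> Re ?z \<le> b + \<bar>a\<bar> * R \<and> 1 \<le> \<bar>Im ?z\<bar>"
      by (auto simp: abs_mult)
    moreover have "(\<epsilon> / \<bar>a\<bar> - pi / 2) * \<bar>Im ?z\<bar> = (\<epsilon> - pi / 2 * \<bar>a\<bar>) * \<bar>Im s\<bar>"
        "(\<epsilon> / \<bar>a\<bar> + pi / 2) * \<bar>Im ?z\<bar> = (\<epsilon> + pi / 2 * \<bar>a\<bar>) * \<bar>Im s\<bar>"
      using assms by (auto simp: abs_mult field_simps)
    ultimately show ?thesis using C[of ?z] by simp
  qed
  then show ?thesis using that by blast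
qed


section \<open>Fourier inversion for an integrable characteristic function\<close>

context real_distribution
begin

text \<open>Left complex valued; that the values are real and nonnegative is read off in
  \<open>inverse_char_real_nonneg\<close> from the measure that the function represents.\<close>

definition inverse_char :: "real \<Rightarrow> complex" where
  "inverse_char y = 1 / (2 * of_real pi) * (CLINT t|lborel. iexp (-(t * y)) * char M t)"

context
  assumes integrable_char: "integrable lborel (char M)"
begin

lemma integrable_iexp_char: "integrable lborel (\<lambda>t. iexp (-(t * y)) * char M t)"
  by (rule Bochner_Integration.integrable_bound[OF integrable_char]) (auto simp: norm_mult)

text \<open>A crude bound that makes the mass of short intervals small and thereby excludes
  atoms.\<close>

lemma inverse_char_bounded: "cmod (inverse_char y) \<le> (LINT t|lborel. cmod (char M t))"
proof -
  have "cmod (CLINT t|lborel. iexp (-(t * y)) * char M t) \<le> (LINT t|lborel. cmod (char M t))"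
    using integral_norm_bound[of lborel "\<lambda>t. iexp (-(t * y)) * char M t"] by (simp add: norm_mult)
  moreover have "cmod (inverse_char y) = cmod (CLINT t|lborel. iexp (-(t * y)) * char M t) / (2 * pi)"
    by (simp add: inverse_char_def norm_divide norm_mult)
  moreover have "x / (2 * pi) \<le> x" if "0 \<le> x" for x :: real
    using that pi_gt3 by (simp add: divide_le_eq mult_le_cancel_left1)
  ultimately show ?thesis by (metis norm_ge_zero order_trans)
qed

lemma isCont_inverse_char: "isCont inverse_char y"
  unfolding continuous_at_sequentially comp_def
proof (intro allI impI)
  fix X :: "nat \<Rightarrow> real" assume X: "X \<longlonglongrightarrow> y"
  have "(\<lambda>n. CLINT t|lborel. iexp (-(t * X n)) * char M t) \<longlonglongrightarrow> (CLINT t|lborel. iexp (-(t * y)) * char M t)"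
  proof (rule integral_dominated_convergence[where w = "\<lambda>t. cmod (char M t)"])
    show "AE t in lborel. (\<lambda>n. iexp (-(t * X n)) * char M t) \<longlonglongrightarrow> iexp (-(t * y)) * char M t"
      by (intro AE_I2 tendsto_intros X)
  qed (use integrable_char in \<open>auto simp: norm_mult\<close>)
  then show "(\<lambda>n. inverse_char (X n)) \<longlonglongrightarrow> inverse_char y"
    unfolding inverse_char_def by (intro tendsto_mult tendsto_const)
qed

lemma continuous_on_inverse_char: "continuous_on A inverse_char"
  by (simp add: continuous_at_imp_continuous_on isCont_inverse_char)

text \<open>The right-hand side is the kernel of Levy's inversion formula; as an integral over y it
  becomes accessible to Fubini.\<close>

lemma iexp_integral:
  assumes "a \<le> b" "t \<noteq> 0"
  shows "(CLINT y|lborel. indicator {a..b} y *\<^sub>R iexp (-(t * y))) = (iexp (-(t * a)) - iexp (-(t * b))) / (\<i> * t)"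
proof -
  have "(CLINT y|lborel. indicator {a..b} y *\<^sub>R iexp (-(t * y))) =
      (\<lambda>y. - iexp (-(t * y)) / (\<i> * t)) b - (\<lambda>y. - iexp (-(t * y)) / (\<i> * t)) a"
    using assms
    by (intro integral_FTC_atLeastAtMost)
       (auto intro!: derivative_eq_intros continuous_intros has_vector_derivative_real_field simp: field_simps)
  then show ?thesis by (simp add: diff_divide_distrib)
qed

text \<open>Levy's formula gives the mass as a limit of truncated integrals when the endpoints are
  not atoms. The kernel is bounded by b - a, so integrability of \<open>char M\<close> turns the
  limit into one absolutely convergent integral, and Fubini moves the integration over [a, b]
  outside.\<close>

lemma measure_Ioc_eq_integral:
  assumes "a \<le> b" "measure M {a} = 0" "measure M {b} = 0"
  shows "of_real (measure M {a<..b}) = (CLINT y|lborel. indicator {a..b} y *\<^sub>R inverse_char y)"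
proof -
  let ?K = "\<lambda>t::real. (iexp (-(t * a)) - iexp (-(t * b))) / (\<i> * t) * char M t"
  have K: "AE t in lborel. cmod (?K t) \<le> (b - a) * cmod (char M t)"
  proof -
    have "AE t in lborel. t \<noteq> (0::real)" by (rule AE_lborel_singleton)
    then show ?thesis
    proof eventually_elim
      case (elim t)
      \<comment> \<open>The bound is applied to the interval from -b to -a, whose exponentials are
        those of the kernel.\<close>
      then show ?case unfolding norm_mult[of _ "char M t"]
        using Levy_Inversion_aux2[of "-b" "-a" t] assms by (intro mult_right_mono) auto
    qed
  qed
  have "(\<lambda>T. CLINT t|lborel. indicator {- real T<..<real T} t *\<^sub>R ?K t) \<longlonglongrightarrow> (CLINT t|lborel. ?K t)"
  proof (rule integral_dominated_convergence[where w = "\<lambda>t. (b - a) * cmod (char M t)"])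
    show "AE t in lborel. (\<lambda>T. indicator {- real T<..<real T} t *\<^sub>R ?K t) \<longlonglongrightarrow> ?K t"
    proof (intro AE_I2)
      fix t
      obtain N where N: "\<bar>t\<bar> < real N" using reals_Archimedean2 by blast
      have "\<forall>\<^sub>F T in sequentially. t \<in> {- real T<..<real T}"
        using eventually_ge_at_top[of N] by eventually_elim (use N in auto)
      then have "\<forall>\<^sub>F T in sequentially. indicator {- real T<..<real T} t *\<^sub>R ?K t = ?K t"
        by eventually_elim simp
      then show "(\<lambda>T. indicator {- real T<..<real T} t *\<^sub>R ?K t) \<longlonglongrightarrow> ?K t"
        by (rule tendsto_eventually)
    qed
    show "AE t in lborel. cmod (indicator {- real T<..<real T} t *\<^sub>R ?K t) \<le> (b - a) * cmod (char M t)" for T :: nat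
      using K by eventually_elim (use assms in \<open>auto split: split_indicator\<close>)
  qed (use integrable_char in auto)
  then have "(\<lambda>T. 1 / (2 * pi) * (CLBINT t=-real T..real T. ?K t)) \<longlonglongrightarrow> 1 / (2 * pi) * (CLINT t|lborel. ?K t)"
    by (intro tendsto_mult tendsto_const)
       (simp add: interval_lebesgue_integral_def set_lebesgue_integral_def einterval_eq)
  moreover have "(\<lambda>T. 1 / (2 * pi) * (CLBINT t=-real T..real T. ?K t)) \<longlonglongrightarrow> of_real (measure M {a<..b})"
    using Levy_Inversion[OF assms] by simp
  ultimately have "of_real (measure M {a<..b}) = of_real (1 / (2 * pi)) * (CLINT t|lborel. ?K t)"
    using LIMSEQ_unique by blast
  also have "(CLINT t|lborel. ?K t) =
      (CLINT t|lborel. (CLINT y|lborel. indicator {a..b} y *\<^sub>R (iexp (-(t * y)) * char M t)))"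
  proof (rule integral_cong_AE)
    show "AE t in lborel. ?K t = (CLINT y|lborel. indicator {a..b} y *\<^sub>R (iexp (-(t * y)) * char M t))"
      using AE_lborel_singleton[of 0]
    proof eventually_elim
      case (elim t)
      then have "?K t = (CLINT y|lborel. indicator {a..b} y *\<^sub>R iexp (-(t * y))) * char M t"
        by (subst iexp_integral[OF assms(1)]) simp_all
      also have "\<dots> = (CLINT y|lborel. (indicator {a..b} y *\<^sub>R iexp (-(t * y))) * char M t)"
        by (rule integral_mult_left_zero[symmetric])
      finally show ?case by (simp only: mult_scaleR_left)
    qed
  qed auto
  also have "\<dots> = (CLINT y|lborel. (CLINT t|lborel. indicator {a..b} y *\<^sub>R (iexp (-(t * y)) * char M t)))"
  proof (rule lborel_pair.Fubini_integral, rule lborel_pair.Fubini_integrable)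
    have "(LINT t|lborel. norm (case (y, t) of (y, t) \<Rightarrow> indicator {a..b} y *\<^sub>R (iexp (-(t * y)) * char M t)))
       = indicator {a..b} y * (LINT t|lborel. cmod (char M t))" for y
      by (simp add: norm_mult)
    then show "integrable lborel (\<lambda>y. LINT t|lborel. norm (case (y, t) of (y, t) \<Rightarrow> indicator {a..b} y *\<^sub>R (iexp (-(t * y)) * char M t)))"
      by (simp only:) (intro integrable_mult_left integrable_real_indicator, auto simp: emeasure_lborel_Icc_eq)
    show "AE y in lborel. integrable lborel (\<lambda>t. case (y, t) of (y, t) \<Rightarrow> indicator {a..b} y *\<^sub>R (iexp (-(t * y)) * char M t))"
      using integrable_iexp_char by auto
  qed auto
  also have "of_real (1 / (2 * pi)) * \<dots> = (CLINT y|lborel. indicator {a..b} y *\<^sub>R inverse_char y)"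
    by (simp add: inverse_char_def flip: integral_mult_right_zero)
  finally show ?thesis .
qed

lemma integrable_indicator_inverse_char: "integrable lborel (\<lambda>y. indicator {a..b} y *\<^sub>R inverse_char y)"
  using borel_integrable_atLeastAtMost'[OF continuous_on_inverse_char] by (simp add: set_integrable_def)

text \<open>Atoms are countable, so x lies between points a and b that are not atoms and are as
  close as desired; the mass of (a, b] is at most b - a times the bound of
  \<open>inverse_char\<close>. This frees the interval formula from its conditions on the
  endpoints.\<close>

lemma measure_singleton_eq_0: "measure M {x} = 0"
proof -
  define B where "B = (LINT t|lborel. cmod (char M t))"
  have B: "B \<ge> 0" by (simp add: B_def)
  have le: "measure M {x} \<le> 2 * e * B" if e: "e > 0" for e
  proof -
    obtain a where a: "a \<in> {x - e<..<x}" "\<not> measure M {a} > 0"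
      using open_minus_countable[OF countable_atoms, of "{x - e<..<x}"] e by auto
    obtain b where b: "b \<in> {x<..<x + e}" "\<not> measure M {b} > 0"
      using open_minus_countable[OF countable_atoms, of "{x<..<x + e}"] e by auto
    have 0: "measure M {a} = 0" "measure M {b} = 0" using a b by (metis measure_nonneg antisym_conv1)+
    have "measure M {x} \<le> measure M {a<..b}" using a b by (intro finite_measure_mono) auto
    also have "\<dots> = cmod (CLINT y|lborel. indicator {a..b} y *\<^sub>R inverse_char y)"
      using measure_Ioc_eq_integral[of a b] a b 0
      by (simp flip: measure_Ioc_eq_integral)
    also have "\<dots> \<le> (LINT y|lborel. indicator {a..b} y * B)"
    proof (rule order_trans[OF integral_norm_bound integral_mono])
      show "integrable lborel (\<lambda>y. cmod (indicator {a..b} y *\<^sub>R inverse_char y))"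
        by (rule integrable_norm[OF integrable_indicator_inverse_char])
      show "integrable lborel (\<lambda>y. indicator {a..b} y * B)"
        by (intro integrable_mult_left integrable_real_indicator) (auto simp: emeasure_lborel_Icc_eq)
    qed (use inverse_char_bounded in \<open>auto simp: B_def split: split_indicator\<close>)
    also have "\<dots> = (b - a) * B" using a b by simp
    also have "\<dots> \<le> 2 * e * B" using a b B by (intro mult_right_mono) auto
    finally show ?thesis .
  qed
  have "measure M {x} \<le> 0"
  proof (rule field_le_epsilon)
    fix e :: real assume "e > 0"
    \<comment> \<open>B may be 0, hence B + 1 in the denominator.\<close>
    have "measure M {x} \<le> 2 * (e / (2 * (B + 1))) * B" using B \<open>e > 0\<close> by (intro le) auto
    also have "\<dots> \<le> e" using B \<open>e > 0\<close> by (simp add: field_simps)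
    finally show "measure M {x} \<le> 0 + e" by simp
  qed
  then show ?thesis by (simp add: antisym)
qed

lemma measure_Ioc_eq_HK_integral:
  assumes "a \<le> b"
  shows "of_real (measure M {a<..b}) = integral {a..b} inverse_char"
  using measure_Ioc_eq_integral[OF assms measure_singleton_eq_0 measure_singleton_eq_0]
    set_borel_integral_eq_integral(2)[of "{a..b}" inverse_char] integrable_indicator_inverse_char[of a b]
  by (simp add: set_integrable_def set_lebesgue_integral_def)

text \<open>By the fundamental theorem of calculus \<open>inverse_char x\<close> is the derivative
  at x of the mass of (x - 1, u] as a function of u, and this function is real and nondecreasing.
  The base point x - 1 makes x an interior point.\<close>

lemma inverse_char_real_nonneg: "Im (inverse_char x) = 0" "Re (inverse_char x) \<ge> 0"
proof -
  define m where "m u = measure M {x - 1<..u}" for u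
  have "((\<lambda>u. integral {x - 1..u} inverse_char) has_vector_derivative inverse_char x) (at x within {x - 1..x + 1})"
    by (rule integral_has_vector_derivative[OF continuous_on_inverse_char]) auto
  then have "((\<lambda>u. integral {x - 1..u} inverse_char) has_vector_derivative inverse_char x) (at x)"
    by (simp add: at_within_Icc_at)
  then have d: "((\<lambda>u. of_real (m u)) has_vector_derivative inverse_char x) (at x)"
    by (rule has_vector_derivative_transform_within_open[where S = "{x - 1<..<x + 1}"])
       (auto simp: m_def measure_Ioc_eq_HK_integral)
  from bounded_linear.has_vector_derivative[OF bounded_linear_Im d]
  have "((\<lambda>u. 0) has_vector_derivative Im (inverse_char x)) (at x)" by simp
  then show "Im (inverse_char x) = 0"
    using has_vector_derivative_const vector_derivative_unique_at by blast
  from bounded_linear.has_vector_derivative[OF bounded_linear_Re d]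
  have "(m has_real_derivative Re (inverse_char x)) (at x)"
    by (simp add: has_real_derivative_iff_has_vector_derivative)
  moreover have "mono_on UNIV m"
    unfolding m_def by (intro mono_onI finite_measure_mono) auto
  ultimately show "Re (inverse_char x) \<ge> 0"
    using mono_on_imp_deriv_nonneg[of UNIV m] by auto
qed

text \<open>Half-open intervals generate the Borel sets and are stable under intersection; on them
  the interval formula applies, as (a, b] and [a, b] differ by a null set.\<close>

theorem density_inverse_char: "M = density lborel (\<lambda>y. ennreal (Re (inverse_char y)))"
proof (rule measure_eqI_generator_eq[where \<Omega> = UNIV and E = "range (\<lambda>(a, b). {a<..b::real})" and A = "\<lambda>n. {- real n<..real n}"])
  have meas: "(\<lambda>y. ennreal (Re (inverse_char y))) \<in> borel_measurable borel"
    by (intro measurable_compose[OF _ measurable_ennreal] borel_measurable_continuous_onI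
          continuous_intros continuous_on_inverse_char)
  show "Int_stable (range (\<lambda>(a, b). {a<..b::real}))"
    unfolding Int_stable_def by auto
  show "emeasure M X = emeasure (density lborel (\<lambda>y. ennreal (Re (inverse_char y)))) X"
    if "X \<in> range (\<lambda>(a, b). {a<..b::real})" for X
  proof -
    obtain a b where X: "X = {a<..b}" using \<open>X \<in> _\<close> by auto
    show ?thesis
    proof (cases "a \<le> b")
      case True
      have "emeasure (density lborel (\<lambda>y. ennreal (Re (inverse_char y)))) {a<..b} =
          (\<integral>\<^sup>+y. ennreal (Re (inverse_char y)) * indicator {a<..b} y \<partial>lborel)"
        using meas by (intro emeasure_density) auto
      also have "\<dots> = (\<integral>\<^sup>+y. ennreal (Re (indicator {a..b} y *\<^sub>R inverse_char y)) \<partial>lborel)"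
      proof (rule nn_integral_cong_AE)
        show "AE y in lborel. ennreal (Re (inverse_char y)) * indicator {a<..b} y =
            ennreal (Re (indicator {a..b} y *\<^sub>R inverse_char y))"
          using AE_lborel_singleton[of a] by eventually_elim (auto split: split_indicator)
      qed
      also have "\<dots> = ennreal (LINT y|lborel. Re (indicator {a..b} y *\<^sub>R inverse_char y))"
        using inverse_char_real_nonneg
        by (intro nn_integral_eq_integral integrable_Re integrable_indicator_inverse_char) auto
      also have "(LINT y|lborel. Re (indicator {a..b} y *\<^sub>R inverse_char y)) =
          Re (CLINT y|lborel. indicator {a..b} y *\<^sub>R inverse_char y)"
        by (rule integral_Re[OF integrable_indicator_inverse_char])
      also have "\<dots> = measure M {a<..b}"
        using measure_Ioc_eq_integral[OF True measure_singleton_eq_0 measure_singleton_eq_0]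
        by (metis Re_complex_of_real)
      finally show ?thesis by (simp add: X emeasure_eq_measure)
    qed (simp add: X)
  qed
  show "(\<Union>n. {- real n<..real n}) = UNIV"
    by (auto simp: minus_less_iff) (meson abs_less_iff less_imp_le reals_Archimedean2)
qed (auto simp: borel_sigma_sets_Ioc)

end

end


section \<open>Absolutely convergent integrals along vertical lines\<close>

text \<open>Comparison with 1 / (1 + t^2); the constant comes from exp x \<ge> 1 + x + x^2 / 2 at x
  = \<kappa> |t|.\<close>

lemma integrable_exp_minus_abs:
  fixes \<kappa> :: real
  assumes "\<kappa> > 0"
  shows "integrable lborel (\<lambda>t. exp (- \<kappa> * \<bar>t\<bar>))"
proof (rule Bochner_Integration.integrable_bound)
  show "integrable lborel (\<lambda>t. (1 + 2 / \<kappa>\<^sup>2) * inverse (1 + t\<^sup>2))"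
    using integrable_inverse_1_plus_square by (simp add: set_integrable_def)
  show "AE t in lborel. norm (exp (- \<kappa> * \<bar>t\<bar>)) \<le> norm ((1 + 2 / \<kappa>\<^sup>2) * inverse (1 + t\<^sup>2))"
  proof (intro AE_I2)
    fix t :: real
    have e: "1 + \<kappa> * \<bar>t\<bar> + (\<kappa> * \<bar>t\<bar>)\<^sup>2 / 2 \<le> exp (\<kappa> * \<bar>t\<bar>)"
      using assms by (intro exp_lower_Taylor_quadratic) auto
    have "1 \<le> exp (\<kappa> * \<bar>t\<bar>)" using assms by simp
    moreover have "\<kappa>\<^sup>2 * t\<^sup>2 \<le> 2 * exp (\<kappa> * \<bar>t\<bar>)"
      using e assms mult_nonneg_nonneg[of \<kappa> "\<bar>t\<bar>"] unfolding power_mult_distrib power2_abs by linarith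
    then have "t\<^sup>2 \<le> 2 / \<kappa>\<^sup>2 * exp (\<kappa> * \<bar>t\<bar>)" using assms by (simp add: field_simps)
    ultimately have "1 + t\<^sup>2 \<le> (1 + 2 / \<kappa>\<^sup>2) * exp (\<kappa> * \<bar>t\<bar>)" unfolding distrib_right by linarith
    moreover have "1 + t\<^sup>2 > 0" by (simp add: add_pos_nonneg)
    ultimately have "exp (- \<kappa> * \<bar>t\<bar>) \<le> (1 + 2 / \<kappa>\<^sup>2) * inverse (1 + t\<^sup>2)"
      by (simp add: exp_minus field_simps)
    then show "norm (exp (- \<kappa> * \<bar>t\<bar>)) \<le> norm ((1 + 2 / \<kappa>\<^sup>2) * inverse (1 + t\<^sup>2))" by simp
  qed
qed measurable

lemma continuous_on_vertical_line:
  assumes "h holomorphic_on {z. p < Re z \<and> Re z < q}" "p < \<sigma>" "\<sigma> < q"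
  shows "continuous_on UNIV (\<lambda>t. h (Complex \<sigma> t))"
  using assms
  by (intro continuous_on_compose2[OF holomorphic_on_imp_continuous_on[OF assms(1)]])
     (auto simp: Complex_eq intro!: continuous_intros)

lemma open_vertical_strip: "open {z. p < Re z \<and> Re z < q}"
  using open_Int[OF open_halfspace_Re_gt[of p] open_halfspace_Re_lt[of q]] by (simp add: Int_def)

lemma convex_vertical_strip: "convex {z. p < Re z \<and> Re z < q}"
  using convex_Int[OF convex_halfspace_Re_gt[of p] convex_halfspace_Re_lt[of q]] by (simp add: Int_def)

text \<open>
  Seen as a function of a complex base point, the integral along the vertical line through it is
  holomorphic and invariant under vertical translations, hence constant.
\<close>

lemma vertical_line_integral_eq:
  assumes hol: "h holomorphic_on {z. p < Re z \<and> Re z < q}" and "\<kappa> > 0"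
    and bound: "\<And>z. p < Re z \<Longrightarrow> Re z < q \<Longrightarrow> cmod (h z) \<le> C * exp (- \<kappa> * \<bar>Im z\<bar>)"
    and "p < \<sigma>" "\<sigma> < q" "p < \<tau>" "\<tau> < q"
  shows "(CLINT t|lborel. h (Complex \<sigma> t)) = (CLINT t|lborel. h (Complex \<tau> t))"
proof -
  define S where "S = {z. p < Re z \<and> Re z < q}"
  have openS: "open S" unfolding S_def by (rule open_vertical_strip)
  have inS: "w + \<i> * of_real t \<in> S" if "w \<in> S" for w t using that by (auto simp: S_def)
  have holS: "h holomorphic_on S" using hol by (simp add: S_def)
  define \<Phi> where "\<Phi> w = (CLINT t|lborel. h (w + \<i> * of_real t))" for w
  have "\<Phi> holomorphic_on S" unfolding \<Phi>_def
  proof (rule holomorphic_on_integral[OF openS])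
    show "(\<lambda>z. h (z + \<i> * of_real t)) holomorphic_on S" for t :: real
      using holomorphic_on_compose_gen[OF _ holS, of "\<lambda>z. z + \<i> * of_real t" S] inS
      by (force simp: o_def intro!: holomorphic_intros)
    show "(\<lambda>t. h (z + \<i> * of_real t)) \<in> borel_measurable lborel" if "z \<in> S" for z
    proof -
      have "continuous_on UNIV (\<lambda>t. h (z + \<i> * of_real t))"
        by (rule continuous_on_compose2[OF holomorphic_on_imp_continuous_on[OF holS]])
           (use inS[OF that] in \<open>auto intro!: continuous_intros\<close>)
      then show ?thesis by (simp add: borel_measurable_continuous_onI)
    qed
    show "\<exists>r>0. \<exists>g. integrable lborel g \<and>
        (\<forall>w\<in>ball z r. \<forall>t\<in>space lborel. cmod (h (w + \<i> * of_real t)) \<le> g t)" if "z \<in> S" for z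
    proof -
      obtain r0 where r0: "r0 > 0" "ball z r0 \<subseteq> S" by (rule openE[OF openS \<open>z \<in> S\<close>])
      \<comment> \<open>For w in \<open>ball z r0\<close> the heights Im w + t and t differ by at
        most |Im z| + r0; the constant exponential factor pays for this.\<close>
      define g where "g t = (\<bar>C\<bar> * exp (\<kappa> * (\<bar>Im z\<bar> + r0))) * exp (- \<kappa> * \<bar>t\<bar>)" for t
      have "integrable lborel g" unfolding g_def using integrable_exp_minus_abs[OF \<open>\<kappa> > 0\<close>] by simp
      moreover have "cmod (h (w + \<i> * of_real t)) \<le> g t" if w: "w \<in> ball z r0" for w t
      proof -
        have "w \<in> S" using w r0 by blast
        from inS[OF this, of t] have "cmod (h (w + \<i> * of_real t)) \<le> C * exp (- \<kappa> * \<bar>Im w + t\<bar>)"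
          using bound[of "w + \<i> * of_real t"] by (simp add: S_def)
        also have "\<dots> \<le> \<bar>C\<bar> * exp (\<kappa> * (\<bar>Im z\<bar> + r0) + - \<kappa> * \<bar>t\<bar>)"
        proof (intro mult_mono)
          have "\<bar>Im (w - z)\<bar> < r0" using abs_Im_le_cmod[of "w - z"] w by (simp add: dist_norm norm_minus_commute)
          then have "\<bar>t\<bar> \<le> \<bar>Im w + t\<bar> + (\<bar>Im z\<bar> + r0)" by simp
          then have "\<kappa> * \<bar>t\<bar> \<le> \<kappa> * (\<bar>Im w + t\<bar> + (\<bar>Im z\<bar> + r0))" using \<open>\<kappa> > 0\<close> by (intro mult_left_mono) auto
          then show "exp (- \<kappa> * \<bar>Im w + t\<bar>) \<le> exp (\<kappa> * (\<bar>Im z\<bar> + r0) + - \<kappa> * \<bar>t\<bar>)"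
            unfolding exp_le_cancel_iff by (simp add: distrib_left)
        qed auto
        finally show ?thesis unfolding exp_add by (simp add: g_def mult.assoc)
      qed
      ultimately show ?thesis using r0 by blast
    qed
  qed
  have inv: "\<Phi> (w + \<i> * of_real s) = \<Phi> w" for w s
    using lborel_integral_real_affine[of 1 "\<lambda>t. h (w + \<i> * of_real t)" s]
    by (simp add: \<Phi>_def algebra_simps)
  \<comment> \<open>The derivative in the vertical direction vanishes by invariance, and for a
    holomorphic function it is i times the complex derivative.\<close>
  have "(\<Phi> has_field_derivative 0) (at z)" if z: "z \<in> S" for z
  proof -
    obtain D where D: "(\<Phi> has_field_derivative D) (at z)"
      using \<open>\<Phi> holomorphic_on S\<close> openS z holomorphic_derivI by blast
    have "((\<lambda>s. \<Phi> (z + \<i> * s)) has_field_derivative D * \<i>) (at 0)"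
      by (rule DERIV_chain'[of "\<lambda>s. z + \<i> * s"]) (use D in \<open>auto intro!: derivative_eq_intros\<close>)
    then have "((\<lambda>s. \<Phi> (z + \<i> * of_real s)) has_vector_derivative D * \<i>) (at 0)"
      using has_vector_derivative_real_field[of "\<lambda>s. \<Phi> (z + \<i> * s)" _ 0] by simp
    then have "D * \<i> = 0" unfolding inv
      using has_vector_derivative_const vector_derivative_unique_at by blast
    then show ?thesis using D by simp
  qed
  then obtain c where "\<And>z. z \<in> S \<Longrightarrow> \<Phi> z = c"
    using has_field_derivative_zero_constant[of S \<Phi>] convex_vertical_strip[of p q]
    by (auto simp: S_def has_field_derivative_at_within)
  then have "\<Phi> (of_real \<sigma>) = \<Phi> (of_real \<tau>)" using assms by (simp add: S_def)
  then show ?thesis by (simp add: \<Phi>_def Complex_eq)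
qed

text \<open>At s = \<sigma> + i t the modulus of exp (-w s) is exp (-\<sigma> Re w + t Im w): a
  nonreal w uses up |Im w| of the decay rate, while Re w affects only the constant.\<close>

lemma exp_line_integrand_bound:
  assumes bound: "\<And>t. cmod (F (Complex \<sigma> t)) \<le> C * exp (- \<kappa> * \<bar>t\<bar>)"
  shows "cmod (exp (- w * Complex \<sigma> t) * F (Complex \<sigma> t)) \<le>
    C * exp (\<bar>\<sigma>\<bar> * \<bar>Re w\<bar>) * exp (- (\<kappa> - \<bar>Im w\<bar>) * \<bar>t\<bar>)"
proof -
  have "- (\<sigma> * Re w) \<le> \<bar>\<sigma>\<bar> * \<bar>Re w\<bar>" "t * Im w \<le> \<bar>t\<bar> * \<bar>Im w\<bar>"
    by (metis abs_ge_minus_self abs_mult) (metis abs_ge_self abs_mult)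
  then have "cmod (exp (- w * Complex \<sigma> t)) \<le> exp (\<bar>\<sigma>\<bar> * \<bar>Re w\<bar> + \<bar>Im w\<bar> * \<bar>t\<bar>)"
    by (simp add: mult.commute)
  then have "cmod (exp (- w * Complex \<sigma> t) * F (Complex \<sigma> t)) \<le>
      exp (\<bar>\<sigma>\<bar> * \<bar>Re w\<bar> + \<bar>Im w\<bar> * \<bar>t\<bar>) * (C * exp (- \<kappa> * \<bar>t\<bar>))"
    unfolding norm_mult by (intro mult_mono bound) auto
  then show ?thesis by (simp add: left_diff_distrib exp_add exp_diff exp_minus field_simps)
qed

text \<open>The source of smoothness: the decay rate \<kappa> leaves room for the inversion integral
  to converge at complex w, so the density extends off the real axis.\<close>

lemma holomorphic_on_exp_line_integral:
  assumes cont: "continuous_on UNIV (\<lambda>t. F (Complex \<sigma> t))"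
    and bound: "\<And>t. cmod (F (Complex \<sigma> t)) \<le> C * exp (- \<kappa> * \<bar>t\<bar>)"
  shows "(\<lambda>w. CLINT t|lborel. exp (- w * Complex \<sigma> t) * F (Complex \<sigma> t)) holomorphic_on {w. \<bar>Im w\<bar> < \<kappa>}"
proof (rule holomorphic_on_integral)
  show "open {w. \<bar>Im w\<bar> < \<kappa>}"
    by (intro open_Collect_less continuous_intros)
  show "(\<lambda>t. exp (- w * Complex \<sigma> t) * F (Complex \<sigma> t)) \<in> borel_measurable lborel" for w
    by (auto simp: Complex_eq intro!: borel_measurable_continuous_onI continuous_intros cont[unfolded Complex_eq])
  fix z assume z: "z \<in> {w. \<bar>Im w\<bar> < \<kappa>}"
  \<comment> \<open>Half of the decay rate left at z, so that a rate of at least r remains at every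
    w in \<open>ball z r\<close>.\<close>
  define r where "r = (\<kappa> - \<bar>Im z\<bar>) / 2"
  have r: "r > 0" using z by (simp add: r_def)
  define g where "g t = C * exp (\<bar>\<sigma>\<bar> * (\<bar>Re z\<bar> + r)) * exp (- r * \<bar>t\<bar>)" for t
  have C: "C \<ge> 0" using order_trans[OF norm_ge_zero bound[of 0]] by simp
  have "cmod (exp (- w * Complex \<sigma> t) * F (Complex \<sigma> t)) \<le> g t" if w: "w \<in> ball z r" for w t
  proof -
    have "\<bar>Re (w - z)\<bar> < r" "\<bar>Im (w - z)\<bar> < r"
      using abs_Re_le_cmod[of "w - z"] abs_Im_le_cmod[of "w - z"] w
      by (simp_all add: dist_norm norm_minus_commute)
    moreover have "\<kappa> = 2 * r + \<bar>Im z\<bar>" by (simp add: r_def field_simps)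
    ultimately have le: "\<bar>Re w\<bar> \<le> \<bar>Re z\<bar> + r" "r \<le> \<kappa> - \<bar>Im w\<bar>"
      by simp_all
    have "cmod (exp (- w * Complex \<sigma> t) * F (Complex \<sigma> t)) \<le>
        C * exp (\<bar>\<sigma>\<bar> * \<bar>Re w\<bar>) * exp (- (\<kappa> - \<bar>Im w\<bar>) * \<bar>t\<bar>)"
      by (rule exp_line_integrand_bound[OF bound])
    also have "\<dots> \<le> g t" unfolding g_def
    proof (intro mult_mono)
      have "r * \<bar>t\<bar> \<le> (\<kappa> - \<bar>Im w\<bar>) * \<bar>t\<bar>" using le by (intro mult_right_mono) auto
      then show "exp (- (\<kappa> - \<bar>Im w\<bar>) * \<bar>t\<bar>) \<le> exp (- r * \<bar>t\<bar>)" by (simp add: left_diff_distrib)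
    qed (use le C in \<open>auto intro!: mult_left_mono\<close>)
    finally show ?thesis .
  qed
  moreover have "integrable lborel g" unfolding g_def using integrable_exp_minus_abs[OF r] by simp
  ultimately show "\<exists>r>0. \<exists>g. integrable lborel g \<and>
      (\<forall>w\<in>ball z r. \<forall>t\<in>space lborel. cmod (exp (- w * Complex \<sigma> t) * F (Complex \<sigma> t)) \<le> g t)"
    using r by blast
qed (auto intro!: holomorphic_intros)

lemma integrable_exp_line:
  assumes cont: "continuous_on UNIV (\<lambda>t. F (Complex \<sigma> t))"
    and bound: "\<And>t. cmod (F (Complex \<sigma> t)) \<le> C * exp (- \<kappa> * \<bar>t\<bar>)" and "\<bar>Im w\<bar> < \<kappa>"
  shows "integrable lborel (\<lambda>t. exp (- w * Complex \<sigma> t) * F (Complex \<sigma> t))"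
proof (rule Bochner_Integration.integrable_bound)
  show "integrable lborel (\<lambda>t. C * exp (\<bar>\<sigma>\<bar> * \<bar>Re w\<bar>) * exp (- (\<kappa> - \<bar>Im w\<bar>) * \<bar>t\<bar>))"
    using integrable_exp_minus_abs[of "\<kappa> - \<bar>Im w\<bar>"] assms by simp
  show "(\<lambda>t. exp (- w * Complex \<sigma> t) * F (Complex \<sigma> t)) \<in> borel_measurable lborel"
    by (auto simp: Complex_eq intro!: borel_measurable_continuous_onI continuous_intros cont[unfolded Complex_eq])
  show "AE t in lborel. cmod (exp (- w * Complex \<sigma> t) * F (Complex \<sigma> t)) \<le>
     norm (C * exp (\<bar>\<sigma>\<bar> * \<bar>Re w\<bar>) * exp (- (\<kappa> - \<bar>Im w\<bar>) * \<bar>t\<bar>))"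
    using exp_line_integrand_bound[OF bound] by (intro AE_I2) (metis abs_ge_self order_trans real_norm_def)
qed


section \<open>Densities of Y and of X = exp Y\<close>

text \<open>
  The exponentially tilted law of \<open>Y\<close> has the characteristic function \<open>\<phi>(t) / \<phi>(0)\<close>, so Fourier
  inversion applies to it, and undoing the tilt gives the density of \<open>Y\<close>.
\<close>

lemma (in prob_space) distributed_of_integrable_moment_line:
  fixes Y :: "'a \<Rightarrow> real" and \<sigma> :: real
  assumes Y[measurable]: "Y \<in> borel_measurable M"
    and int: "integrable M (\<lambda>\<omega>. exp (\<sigma> * Y \<omega>))"
    and \<phi>: "\<And>t. \<phi> t = (CLINT \<omega>|M. exp (Complex \<sigma> t * of_real (Y \<omega>)))"
    and int\<phi>: "integrable lborel \<phi>"
  obtains f where "\<And>y. f y \<ge> 0" "distributed M lborel Y (\<lambda>y. ennreal (f y))"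
    "\<And>y. of_real (f y) = 1 / (2 * of_real pi) * (CLINT t|lborel. exp (- of_real y * Complex \<sigma> t) * \<phi> t)"
proof -
  define m where "m = (\<integral>\<omega>. exp (\<sigma> * Y \<omega>) \<partial>M)"
  have "m \<ge> 0" by (simp add: m_def)
  moreover have "m \<noteq> 0"
  proof
    assume "m = 0"
    then have "AE \<omega> in M. exp (\<sigma> * Y \<omega>) = 0"
      using integral_nonneg_eq_0_iff_AE[OF int] by (simp add: m_def)
    then have "AE \<omega> in M. False" by simp
    then show False by simp
  qed
  ultimately have m: "m > 0" by simp
  define M' where "M' = density M (\<lambda>\<omega>. ennreal (exp (\<sigma> * Y \<omega>) / m))"
  define N where "N = distr M' borel Y"
  have "emeasure M' (space M') = (\<integral>\<^sup>+\<omega>. ennreal (exp (\<sigma> * Y \<omega>) / m) \<partial>M)"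
    by (simp add: M'_def emeasure_density cong: nn_integral_cong)
  also have "\<dots> = ennreal (\<integral>\<omega>. exp (\<sigma> * Y \<omega>) / m \<partial>M)"
    using int m by (intro nn_integral_eq_integral) auto
  also have "(\<integral>\<omega>. exp (\<sigma> * Y \<omega>) / m \<partial>M) = 1" using m by (simp add: m_def[symmetric])
  finally have "prob_space M'" by (intro prob_spaceI) simp
  have YM'[measurable]: "Y \<in> borel_measurable M'" by (simp add: M'_def)
  interpret N: real_distribution N
    unfolding N_def by (rule prob_space.real_distribution_distr[OF \<open>prob_space M'\<close> YM'])
  \<comment> \<open>The tilt supplies the real part of the exponent: exp (\<sigma> Y) and exp (i t
    Y) combine to exp ((\<sigma> + i t) Y).\<close>
  have char: "char N t = \<phi> t / m" for t
  proof -
    have "char N t = (CLINT \<omega>|M'. iexp (t * Y \<omega>))"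
      unfolding char_def N_def by (subst integral_distr) auto
    also have "\<dots> = (CLINT \<omega>|M. (exp (\<sigma> * Y \<omega>) / m) *\<^sub>R iexp (t * Y \<omega>))"
      unfolding M'_def using m by (intro integral_density) auto
    also have "\<dots> = (CLINT \<omega>|M. exp (Complex \<sigma> t * of_real (Y \<omega>)) / m)"
      by (intro Bochner_Integration.integral_cong refl)
         (simp add: scaleR_conv_of_real exp_of_real[symmetric] Complex_eq distrib_right mult_exp_exp mult.assoc)
    finally show ?thesis by (simp add: \<phi>)
  qed
  have int_char: "integrable lborel (char N)" unfolding char using int\<phi> by simp
  define f where "f y = m * exp (- \<sigma> * y) * Re (N.inverse_char y)" for y
  have nonneg: "Im (N.inverse_char y) = 0" "Re (N.inverse_char y) \<ge> 0" for y
    by (rule N.inverse_char_real_nonneg[OF int_char])+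
  have meas[measurable]: "(\<lambda>y. Re (N.inverse_char y)) \<in> borel_measurable borel"
    by (intro borel_measurable_continuous_onI continuous_intros N.continuous_on_inverse_char[OF int_char])
  \<comment> \<open>The tilt is undone by the reciprocal weight; the two weights multiply to 1 at
    every sample point.\<close>
  have "distr M lborel Y = density N (\<lambda>y. ennreal (m * exp (- \<sigma> * y)))"
  proof (rule measure_eqI)
    fix A assume "A \<in> sets (distr M lborel Y)"
    then have A[measurable]: "A \<in> sets borel" by simp
    have "emeasure (density N (\<lambda>y. ennreal (m * exp (- \<sigma> * y)))) A =
        (\<integral>\<^sup>+y. ennreal (m * exp (- \<sigma> * y)) * indicator A y \<partial>N)"
      by (intro emeasure_density) (auto simp: N_def)
    also have "\<dots> = (\<integral>\<^sup>+\<omega>. ennreal (m * exp (- \<sigma> * Y \<omega>)) * indicator A (Y \<omega>) \<partial>M')"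
      unfolding N_def by (subst nn_integral_distr) auto
    also have "\<dots> = (\<integral>\<^sup>+\<omega>. ennreal (exp (\<sigma> * Y \<omega>) / m) * (ennreal (m * exp (- \<sigma> * Y \<omega>)) * indicator A (Y \<omega>)) \<partial>M)"
      unfolding M'_def by (intro nn_integral_density) auto
    also have "\<dots> = (\<integral>\<^sup>+\<omega>. indicator A (Y \<omega>) \<partial>M)"
    proof (intro nn_integral_cong)
      fix \<omega>
      have "ennreal (exp (\<sigma> * Y \<omega>) / m) * ennreal (m * exp (- \<sigma> * Y \<omega>)) = 1"
        using m by (simp flip: ennreal_mult exp_add)
      then show "ennreal (exp (\<sigma> * Y \<omega>) / m) * (ennreal (m * exp (- \<sigma> * Y \<omega>)) * indicator A (Y \<omega>)) = indicator A (Y \<omega>)"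
        by (simp flip: mult.assoc)
    qed
    also have "\<dots> = emeasure (distr M lborel Y) A"
      by (simp add: emeasure_distr nn_integral_indicator_singleton flip: nn_integral_distr[of Y M borel "indicator A"])
    finally show "emeasure (distr M lborel Y) A = emeasure (density N (\<lambda>y. ennreal (m * exp (- \<sigma> * y)))) A" ..
  qed (simp add: N_def)
  also have "\<dots> = density (density lborel (\<lambda>y. ennreal (Re (N.inverse_char y)))) (\<lambda>y. ennreal (m * exp (- \<sigma> * y)))"
    using N.density_inverse_char[OF int_char] by simp
  also have "\<dots> = density lborel (\<lambda>y. ennreal (f y))"
    using m nonneg by (subst density_density_eq) (auto simp: f_def mult_ac simp flip: ennreal_mult)
  finally have "distributed M lborel Y (\<lambda>y. ennreal (f y))"
    by (simp add: distributed_def f_def)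
  moreover have "f y \<ge> 0" for y using m nonneg by (simp add: f_def)
  moreover have "of_real (f y) = 1 / (2 * of_real pi) * (CLINT t|lborel. exp (- of_real y * Complex \<sigma> t) * \<phi> t)" for y
  proof -
    have "complex_of_real (f y) = of_real (m * exp (- \<sigma> * y)) * N.inverse_char y"
      using nonneg[of y] by (simp add: f_def complex_eq_iff)
    also have "\<dots> = 1 / (2 * of_real pi) * (CLINT t|lborel. of_real (m * exp (- \<sigma> * y)) * (iexp (-(t * y)) * char N t))"
      unfolding N.inverse_char_def by (subst integral_mult_right_zero) simp
    also have "(CLINT t|lborel. of_real (m * exp (- \<sigma> * y)) * (iexp (-(t * y)) * char N t)) =
        (CLINT t|lborel. exp (- of_real y * Complex \<sigma> t) * \<phi> t)"
    proof (intro Bochner_Integration.integral_cong refl)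
      fix t
      have "exp (- of_real y * Complex \<sigma> t) = of_real (exp (- \<sigma> * y)) * iexp (-(t * y))"
        by (simp add: Complex_eq exp_of_real[symmetric] mult_exp_exp algebra_simps)
      then show "of_real (m * exp (- \<sigma> * y)) * (iexp (-(t * y)) * char N t) = exp (- of_real y * Complex \<sigma> t) * \<phi> t"
        using m by (simp add: char)
    qed
    finally show ?thesis .
  qed
  ultimately show ?thesis using that by blast
qed

text \<open>Continuity from below of the measure \<open>density lborel h\<close>. The sets have to
  exhaust only the region where h is nonzero, so intervals inside the positive axis will do for the
  density of X.\<close>

lemma nn_integral_eq_SUP_incseq:
  fixes h :: "real \<Rightarrow> ennreal"
  assumes [measurable]: "h \<in> borel_measurable borel" "\<And>n. B n \<in> sets borel"
    and B: "incseq B" "\<And>x. h x \<noteq> 0 \<Longrightarrow> \<exists>n. x \<in> B n"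
  shows "(\<integral>\<^sup>+x. h x \<partial>lborel) = (SUP n. \<integral>\<^sup>+x. h x * indicator (B n) x \<partial>lborel)"
proof -
  have "(\<integral>\<^sup>+x. h x \<partial>lborel) = (\<integral>\<^sup>+x. h x * indicator (\<Union>n. B n) x \<partial>lborel)"
    using B by (intro nn_integral_cong) (auto simp: indicator_def)
  also have "\<dots> = emeasure (density lborel h) (\<Union>n. B n)"
    by (subst emeasure_density) auto
  also have "\<dots> = (SUP n. emeasure (density lborel h) (B n))"
    using B by (intro SUP_emeasure_incseq[symmetric]) auto
  also have "\<dots> = (SUP n. \<integral>\<^sup>+x. h x * indicator (B n) x \<partial>lborel)"
    by (intro SUP_cong refl emeasure_density) auto
  finally show ?thesis .
qed

lemma real_arch_bounds: "\<exists>n. - real n \<le> x \<and> x \<le> real n"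
proof -
  obtain n where "\<bar>x\<bar> \<le> real n" using real_arch_simple by blast
  then show ?thesis by (intro exI[of _ n]) auto
qed

text \<open>Both laws are compared on \<open>{exp (-n)..exp n}\<close>, where integration by substitution applies.\<close>

lemma (in prob_space) distributed_exp:
  fixes Y :: "'a \<Rightarrow> real" and f :: "real \<Rightarrow> real"
  assumes Y: "distributed M lborel Y (\<lambda>y. ennreal (f y))" and f: "\<And>y. f y \<ge> 0" "f \<in> borel_measurable borel"
    and X[measurable]: "X \<in> borel_measurable M" and XY: "AE \<omega> in M. X \<omega> = exp (Y \<omega>)"
  shows "distributed M lborel X (\<lambda>x. ennreal (if x > 0 then f (ln x) / x else 0))"
proof -
  note [measurable] = f(2)
  have [measurable]: "Y \<in> borel_measurable M" using distributed_measurable[OF Y] by simp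
  define g where "g x = (if x > 0 then f (ln x) / x else 0)" for x
  have g[measurable]: "g \<in> borel_measurable borel" unfolding g_def by measurable
  have "distr M lborel X = density lborel (\<lambda>x. ennreal (g x))"
  proof (rule measure_eqI)
    fix A assume "A \<in> sets (distr M lborel X)"
    then have A[measurable]: "A \<in> sets borel" by simp
    have sub: "(\<integral>\<^sup>+y. ennreal (f y) * indicator A (exp y) * indicator {- real n..real n} y \<partial>lborel) =
        (\<integral>\<^sup>+x. ennreal (g x) * indicator A x * indicator {exp (- real n)..exp (real n)} x \<partial>lborel)" for n
    proof (cases "n = 0")
      \<comment> \<open>The intervals degenerate to the null sets {0} and {1}; the substitution rule
        of the other case is for proper intervals.\<close>
      case True
      have "(\<integral>\<^sup>+y. ennreal (f y) * indicator A (exp y) * indicator {- real n..real n} y \<partial>lborel) = 0"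
        "(\<integral>\<^sup>+x. ennreal (g x) * indicator A x * indicator {exp (- real n)..exp (real n)} x \<partial>lborel) = 0"
        using AE_lborel_singleton[of "0::real"] AE_lborel_singleton[of "1::real"] True
        by (auto simp: nn_integral_0_iff_AE indicator_def)
      then show ?thesis by simp
    next
      case False
      have pos: "x > 0" if "x \<in> {exp (- real n)..exp (real n)}" for x
        using that by (meson atLeastAtMost_iff exp_gt_zero less_le_trans)
      \<comment> \<open>Substitution y = ln x, whose derivative 1 / x is the extra factor in
        g.\<close>
      have "(\<integral>\<^sup>+y. (ennreal (f y) * indicator A (exp y)) * indicator {ln (exp (- real n))..ln (exp (real n))} y \<partial>lborel) =
          (\<integral>\<^sup>+x. (ennreal (f (ln x)) * indicator A (exp (ln x))) * ennreal (1 / x) * indicator {exp (- real n)..exp (real n)} x \<partial>lborel)"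
        by (rule nn_integral_substitution_aux)
           (use False pos in \<open>auto intro!: derivative_eq_intros continuous_intros simp: less_imp_le less_imp_neq[THEN not_sym]\<close>)
      also have "\<dots> = (\<integral>\<^sup>+x. ennreal (g x) * indicator A x * indicator {exp (- real n)..exp (real n)} x \<partial>lborel)"
      proof (intro nn_integral_cong)
        fix x :: real
        show "ennreal (f (ln x)) * indicator A (exp (ln x)) * ennreal (1 / x) * indicator {exp (- real n)..exp (real n)} x =
            ennreal (g x) * indicator A x * indicator {exp (- real n)..exp (real n)} x"
        proof (cases "x \<in> {exp (- real n)..exp (real n)}")
          case True
          then have "x > 0" by (rule pos)
          then have "ennreal (f (ln x)) * ennreal (1 / x) = ennreal (g x)"
            using f by (simp add: g_def flip: ennreal_mult)
          then show ?thesis using \<open>x > 0\<close> by (simp add: mult_ac flip: mult.assoc)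
        qed simp
      qed
      finally show ?thesis by simp
    qed
    have "emeasure (distr M lborel X) A = emeasure M (X -` A \<inter> space M)"
      by (simp add: emeasure_distr)
    also have "\<dots> = emeasure M (Y -` (exp -` A) \<inter> space M)"
      using XY by (intro emeasure_eq_AE) auto
    also have "\<dots> = (\<integral>\<^sup>+y. ennreal (f y) * indicator (exp -` A) y \<partial>lborel)"
      by (rule distributed_emeasure[OF Y]) (simp add: measurable_sets_borel[OF _ A])
    also have "\<dots> = (\<integral>\<^sup>+y. ennreal (f y) * indicator A (exp y) \<partial>lborel)"
      by (intro nn_integral_cong) (simp add: indicator_def)
    also have "\<dots> = (SUP n. \<integral>\<^sup>+y. ennreal (f y) * indicator A (exp y) * indicator {- real n..real n} y \<partial>lborel)"
      by (rule nn_integral_eq_SUP_incseq) (auto simp: incseq_def intro: real_arch_bounds)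
    also have "\<dots> = (SUP n. \<integral>\<^sup>+x. ennreal (g x) * indicator A x * indicator {exp (- real n)..exp (real n)} x \<partial>lborel)"
      by (simp only: sub)
    also have "\<dots> = (\<integral>\<^sup>+x. ennreal (g x) * indicator A x \<partial>lborel)"
    proof (rule nn_integral_eq_SUP_incseq[symmetric])
      fix x assume "ennreal (g x) * indicator A x \<noteq> 0"
      then have "x > 0" by (auto simp: g_def split: if_splits)
      obtain n where "- real n \<le> ln x" "ln x \<le> real n" using real_arch_bounds by blast
      then have "exp (- real n) \<le> exp (ln x)" "exp (ln x) \<le> exp (real n)" by (simp_all only: exp_le_cancel_iff)
      then show "\<exists>n. x \<in> {exp (- real n)..exp (real n)}" using \<open>x > 0\<close> by auto
    qed (auto simp: incseq_def intro: order_trans[rotated])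
    also have "\<dots> = emeasure (density lborel (\<lambda>x. ennreal (g x))) A"
      by (simp add: emeasure_density)
    finally show "emeasure (distr M lborel X) A = emeasure (density lborel (\<lambda>x. ennreal (g x))) A" .
  qed simp
  then show ?thesis by (simp add: distributed_def g_def)
qed


section \<open>Poles and exponential decay of the meromorphic function F\<close>

definition gamma_quotient ::
  "nat \<Rightarrow> nat \<Rightarrow> real \<Rightarrow> real \<Rightarrow> (nat \<Rightarrow> real) \<Rightarrow> (nat \<Rightarrow> real) \<Rightarrow> (nat \<Rightarrow> real) \<Rightarrow> (nat \<Rightarrow> real)
    \<Rightarrow> complex \<Rightarrow> complex" where
  "gamma_quotient J K C D a b a' b' s = of_real C * of_real D powr s *
     (\<Prod>j=1..J. Gamma (of_real (a j) * s + of_real (b j))) /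
     (\<Prod>k=1..K. Gamma (of_real (a' k) * s + of_real (b' k)))"

lemma gamma_type_fun_eq: "gamma_type_fun J K C D a b a' b' = remove_sings (gamma_quotient J K C D a b a' b')"
  by (simp add: gamma_type_fun_def gamma_quotient_def[abs_def])

text \<open>\<open>Gamma\<close> is the inverse of the entire function \<open>rGamma\<close>, with
  inverse 0 = 0, so the identity holds even at poles of \<open>Gamma\<close>. It shows that the
  denominator creates no singularities.\<close>

lemma gamma_quotient_rGamma:
  "gamma_quotient J K C D a b a' b' s = of_real C * of_real D powr s *
     (\<Prod>j=1..J. Gamma (of_real (a j) * s + of_real (b j))) *
     (\<Prod>k=1..K. rGamma (of_real (a' k) * s + of_real (b' k)))"
  by (simp add: gamma_quotient_def Gamma_def divide_inverse prod_inversef[unfolded comp_def])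

text \<open>The factors are meromorphic and \<open>remove_sings\<close> normalises the values, so
  every point is either a point of analyticity or a pole with value 0.\<close>

lemma nicely_meromorphic_gamma_type_fun:
  assumes "D > 0"
  shows "gamma_type_fun J K C D a b a' b' nicely_meromorphic_on UNIV"
  unfolding gamma_type_fun_eq
proof (rule remove_sings_nicely_meromorphic)
  have "(\<lambda>s. rGamma (of_real c * s + of_real d)) meromorphic_on UNIV" for c d :: real
    by (intro analytic_on_imp_meromorphic_on analytic_intros)
  moreover from this have "(\<lambda>s. Gamma (of_real c * s + of_real d)) meromorphic_on UNIV" for c d :: real
    unfolding Gamma_def by (intro meromorphic_intros)
  moreover have "(\<lambda>s. of_real D powr s) meromorphic_on UNIV"
    using assms by (intro analytic_on_imp_meromorphic_on analytic_intros) auto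
  ultimately show "gamma_quotient J K C D a b a' b' meromorphic_on UNIV"
    unfolding gamma_quotient_rGamma[abs_def] by (intro meromorphic_intros)
qed

text \<open>A real affine map with nonzero slope keeps nonreal points nonreal, away from the poles
  of Gamma.\<close>

lemma gamma_quotient_analytic_at:
  assumes "D > 0" "Im s \<noteq> 0" "\<forall>j\<in>{1..J}. a j \<noteq> 0"
  shows "gamma_quotient J K C D a b a' b' analytic_on {s}"
proof -
  have "of_real (a j) * s + of_real (b j) \<notin> \<int>\<^sub>\<le>\<^sub>0" if "j \<in> {1..J}" for j
    using assms(2,3) that by (auto elim!: nonpos_Ints_cases simp: complex_eq_iff)
  then show ?thesis
    unfolding gamma_quotient_rGamma[abs_def] using assms(1) by (intro analytic_intros) auto
qed

lemma gamma_type_fun_eq_quotient: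
  assumes "D > 0" "Im s \<noteq> 0" "\<forall>j\<in>{1..J}. a j \<noteq> 0"
  shows "gamma_type_fun J K C D a b a' b' s = gamma_quotient J K C D a b a' b' s"
  unfolding gamma_type_fun_eq by (intro remove_sings_at_analytic gamma_quotient_analytic_at assms)

lemma gamma_type_fun_pole_real:
  assumes "D > 0" "\<forall>j\<in>{1..J}. a j \<noteq> 0" "is_pole (gamma_type_fun J K C D a b a' b') s"
  shows "Im s = 0"
proof (rule ccontr)
  assume "Im s \<noteq> 0"
  then have "gamma_type_fun J K C D a b a' b' analytic_on {s}"
    unfolding gamma_type_fun_eq
    by (intro remove_sings_analytic_on gamma_quotient_analytic_at assms)
  then show False using assms(3) analytic_at_imp_no_pole by blast
qed

lemma gamma_type_fun_pole_zero:
  assumes "D > 0" "is_pole (gamma_type_fun J K C D a b a' b') s"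
  shows "gamma_type_fun J K C D a b a' b' s = 0"
  using nicely_meromorphic_gamma_type_fun[OF assms(1)] assms(2)
  unfolding nicely_meromorphic_on_def
  by (metis UNIV_I at_neq_bot is_pole_def not_tendsto_and_filterlim_at_infinity)

text \<open>Numerator factors contribute -pi |a_j| / 2 to the rate and denominator factors pi |a'_k|
  / 2, in total -pi \<gamma> / 2; each factor also loses \<epsilon>. Half of the rate is given up to
  cover the losses.\<close>

lemma gamma_type_fun_large_Im_bound:
  assumes D: "D > 0" and a: "\<forall>j\<in>{1..J}. a j \<noteq> 0" and a': "\<forall>k\<in>{1..K}. a' k \<noteq> 0"
    and \<gamma>: "\<gamma> = (\<Sum>j=1..J. \<bar>a j\<bar>) - (\<Sum>k=1..K. \<bar>a' k\<bar>)" "\<gamma> > 0"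
  obtains B T where "\<And>s. \<bar>Re s\<bar> \<le> R \<Longrightarrow> T \<le> \<bar>Im s\<bar> \<Longrightarrow>
    cmod (gamma_type_fun J K C D a b a' b' s) \<le> B * exp (- (pi * \<gamma> / 4) * \<bar>Im s\<bar>)"
proof -
  \<comment> \<open>J + K losses of this size cost at most pi \<gamma> / 4 together; the summand 1
    makes the denominator visibly positive.\<close>
  define \<epsilon> where "\<epsilon> = pi * \<gamma> / 4 / (1 + real J + real K)"
  have \<epsilon>: "\<epsilon> > 0" using \<gamma> by (simp add: \<epsilon>_def)
  have "\<forall>j. \<exists>Cj. j \<in> {1..J} \<longrightarrow> (\<forall>s. \<bar>Re s\<bar> \<le> R \<longrightarrow> 1 / \<bar>a j\<bar> \<le> \<bar>Im s\<bar> \<longrightarrow>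
      cmod (Gamma (of_real (a j) * s + of_real (b j))) \<le> Cj * exp ((\<epsilon> - pi / 2 * \<bar>a j\<bar>) * \<bar>Im s\<bar>))"
    using Gamma_affine_strip_bound[OF bspec[OF a] \<epsilon>] by metis
  then obtain c where c: "\<And>j s. j \<in> {1..J} \<Longrightarrow> \<bar>Re s\<bar> \<le> R \<Longrightarrow> 1 / \<bar>a j\<bar> \<le> \<bar>Im s\<bar> \<Longrightarrow>
      cmod (Gamma (of_real (a j) * s + of_real (b j))) \<le> c j * exp ((\<epsilon> - pi / 2 * \<bar>a j\<bar>) * \<bar>Im s\<bar>)"
    by metis
  have "\<forall>k. \<exists>Ck. k \<in> {1..K} \<longrightarrow> (\<forall>s. \<bar>Re s\<bar> \<le> R \<longrightarrow> 1 / \<bar>a' k\<bar> \<le> \<bar>Im s\<bar> \<longrightarrow>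
      cmod (rGamma (of_real (a' k) * s + of_real (b' k))) \<le> Ck * exp ((\<epsilon> + pi / 2 * \<bar>a' k\<bar>) * \<bar>Im s\<bar>))"
    using Gamma_affine_strip_bound[OF bspec[OF a'] \<epsilon>] by metis
  then obtain c' where c': "\<And>k s. k \<in> {1..K} \<Longrightarrow> \<bar>Re s\<bar> \<le> R \<Longrightarrow> 1 / \<bar>a' k\<bar> \<le> \<bar>Im s\<bar> \<Longrightarrow>
      cmod (rGamma (of_real (a' k) * s + of_real (b' k))) \<le> c' k * exp ((\<epsilon> + pi / 2 * \<bar>a' k\<bar>) * \<bar>Im s\<bar>)"
    by metis
  \<comment> \<open>Beyond T all thresholds 1 / |a_j| and 1 / |a'_k| are passed at once; T \<ge> 1
    also keeps s off the real axis, so that F is the literal quotient there.\<close>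
  define T where "T = 1 + (\<Sum>j=1..J. 1 / \<bar>a j\<bar>) + (\<Sum>k=1..K. 1 / \<bar>a' k\<bar>)"
  have Tj: "1 / \<bar>a j\<bar> \<le> T" if "j \<in> {1..J}" for j
    using member_le_sum[OF that, of "\<lambda>j. 1 / \<bar>a j\<bar>"] sum_nonneg[of "{1..K}" "\<lambda>k. 1 / \<bar>a' k\<bar>"]
    by (simp add: T_def)
  have Tk: "1 / \<bar>a' k\<bar> \<le> T" if "k \<in> {1..K}" for k
    using member_le_sum[OF that, of "\<lambda>k. 1 / \<bar>a' k\<bar>"] sum_nonneg[of "{1..J}" "\<lambda>j. 1 / \<bar>a j\<bar>"]
    by (simp add: T_def)
  have T: "T \<ge> 1" unfolding T_def by (simp add: sum_nonneg add_nonneg_nonneg)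
  define B where "B = \<bar>C\<bar> * exp (\<bar>R\<bar> * \<bar>ln D\<bar>) * (\<Prod>j=1..J. c j) * (\<Prod>k=1..K. c' k)"
  have "cmod (gamma_type_fun J K C D a b a' b' s) \<le> B * exp (- (pi * \<gamma> / 4) * \<bar>Im s\<bar>)"
    if s: "\<bar>Re s\<bar> \<le> R" "T \<le> \<bar>Im s\<bar>" for s
  proof -
    let ?t = "\<bar>Im s\<bar>"
    define P where "P = (\<Prod>j=1..J. c j * exp ((\<epsilon> - pi / 2 * \<bar>a j\<bar>) * ?t))"
    define Q where "Q = (\<Prod>k=1..K. c' k * exp ((\<epsilon> + pi / 2 * \<bar>a' k\<bar>) * ?t))"
    have Pb: "(\<Prod>j=1..J. cmod (Gamma (of_real (a j) * s + of_real (b j)))) \<le> P"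
      unfolding P_def by (intro prod_mono conjI norm_ge_zero c s order_trans[OF Tj]) auto
    have Qb: "(\<Prod>k=1..K. cmod (rGamma (of_real (a' k) * s + of_real (b' k)))) \<le> Q"
      unfolding Q_def by (intro prod_mono conjI norm_ge_zero c' s order_trans[OF Tk]) auto
    have P0: "0 \<le> P" by (rule order_trans[OF _ Pb]) (simp add: prod_nonneg)
    have Q0: "0 \<le> Q" by (rule order_trans[OF _ Qb]) (simp add: prod_nonneg)
    have Db: "cmod (of_real D powr s) \<le> exp (\<bar>R\<bar> * \<bar>ln D\<bar>)"
    proof -
      have "Re s * ln D \<le> \<bar>Re s\<bar> * \<bar>ln D\<bar>" by (metis abs_ge_self abs_mult)
      also have "\<dots> \<le> \<bar>R\<bar> * \<bar>ln D\<bar>" using s by (intro mult_right_mono) auto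
      finally have "Re s * ln D \<le> \<bar>R\<bar> * \<bar>ln D\<bar>" .
      then show ?thesis using D by (simp add: norm_powr_real_powr powr_def)
    qed
    have "gamma_type_fun J K C D a b a' b' s = gamma_quotient J K C D a b a' b' s"
      using D a s T by (intro gamma_type_fun_eq_quotient) auto
    then have "cmod (gamma_type_fun J K C D a b a' b' s) = \<bar>C\<bar> * cmod (of_real D powr s) *
        (\<Prod>j=1..J. cmod (Gamma (of_real (a j) * s + of_real (b j)))) *
        (\<Prod>k=1..K. cmod (rGamma (of_real (a' k) * s + of_real (b' k))))"
      by (simp only: gamma_quotient_rGamma norm_mult prod_norm norm_of_real)
    also have "\<dots> \<le> \<bar>C\<bar> * exp (\<bar>R\<bar> * \<bar>ln D\<bar>) * P * Q"
      by (intro mult_mono Pb Qb Db order_refl mult_nonneg_nonneg P0 Q0 prod_nonneg) auto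
    also have "P = (\<Prod>j=1..J. c j) * exp (\<Sum>j=1..J. (\<epsilon> - pi / 2 * \<bar>a j\<bar>) * ?t)"
      unfolding P_def by (simp add: prod.distrib exp_sum)
    also have "Q = (\<Prod>k=1..K. c' k) * exp (\<Sum>k=1..K. (\<epsilon> + pi / 2 * \<bar>a' k\<bar>) * ?t)"
      unfolding Q_def by (simp add: prod.distrib exp_sum)
    finally have *: "cmod (gamma_type_fun J K C D a b a' b' s) \<le> B *
        exp ((\<Sum>j=1..J. (\<epsilon> - pi / 2 * \<bar>a j\<bar>) * ?t) + (\<Sum>k=1..K. (\<epsilon> + pi / 2 * \<bar>a' k\<bar>) * ?t))"
      by (simp add: B_def exp_add mult_ac)
    \<comment> \<open>The constants c j and c' k come without a sign; B \<ge> 0 follows because the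
      bound dominates a norm, and it allows the exponent to be enlarged.\<close>
    have "0 \<le> B * exp ((\<Sum>j=1..J. (\<epsilon> - pi / 2 * \<bar>a j\<bar>) * ?t) + (\<Sum>k=1..K. (\<epsilon> + pi / 2 * \<bar>a' k\<bar>) * ?t))"
      using * norm_ge_zero order_trans by blast
    then have B0: "0 \<le> B" by (simp add: zero_le_mult_iff)
    have "(\<Sum>j=1..J. (\<epsilon> - pi / 2 * \<bar>a j\<bar>) * ?t) + (\<Sum>k=1..K. (\<epsilon> + pi / 2 * \<bar>a' k\<bar>) * ?t) =
        ((real J + real K) * \<epsilon> - pi / 2 * \<gamma>) * ?t"
      unfolding \<gamma>(1) sum_distrib_right[symmetric] sum_subtractf sum.distrib sum_distrib_left[symmetric]
      by (simp add: algebra_simps)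
    also have "\<dots> \<le> - (pi * \<gamma> / 4) * ?t"
    proof (rule mult_right_mono)
      have "(real J + real K) * \<epsilon> \<le> (1 + real J + real K) * \<epsilon>" using \<epsilon> by simp
      also have "\<dots> = pi * \<gamma> / 4"
      proof -
        have "n * (x / n) = x" if "n > 0" for n x :: real using that by simp
        moreover have "1 + real J + real K > 0" by linarith
        ultimately show ?thesis unfolding \<epsilon>_def by blast
      qed
      moreover have "pi / 2 * \<gamma> = 2 * (pi * \<gamma> / 4)" by simp
      ultimately show "(real J + real K) * \<epsilon> - pi / 2 * \<gamma> \<le> - (pi * \<gamma> / 4)" by linarith
    qed simp
    finally show ?thesis using * B0 by (meson exp_le_cancel_iff mult_left_mono order_trans)
  qed
  then show ?thesis using that by blast
qed

text \<open>The bound for large |Im s| leaves a compact rectangle, on which the continuous quotient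
  of |F| by the exponential is bounded.\<close>

lemma gamma_type_fun_strip_bound:
  assumes D: "D > 0" and a: "\<forall>j\<in>{1..J}. a j \<noteq> 0" and a': "\<forall>k\<in>{1..K}. a' k \<noteq> 0"
    and \<gamma>: "\<gamma> = (\<Sum>j=1..J. \<bar>a j\<bar>) - (\<Sum>k=1..K. \<bar>a' k\<bar>)" "\<gamma> > 0"
    and cont: "continuous_on {s. p \<le> Re s \<and> Re s \<le> q} (gamma_type_fun J K C D a b a' b')"
  obtains B where "\<And>s. p \<le> Re s \<Longrightarrow> Re s \<le> q \<Longrightarrow>
    cmod (gamma_type_fun J K C D a b a' b' s) \<le> B * exp (- (pi * \<gamma> / 4) * \<bar>Im s\<bar>)"
proof -
  let ?F = "gamma_type_fun J K C D a b a' b'"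
  let ?e = "\<lambda>s. exp (- (pi * \<gamma> / 4) * \<bar>Im s\<bar>)"
  obtain B1 T where B1: "\<And>s. \<bar>Re s\<bar> \<le> \<bar>p\<bar> + \<bar>q\<bar> \<Longrightarrow> T \<le> \<bar>Im s\<bar> \<Longrightarrow> cmod (?F s) \<le> B1 * ?e s"
    using gamma_type_fun_large_Im_bound[OF D a a' \<gamma>] by metis
  have "compact ((\<lambda>s. cmod (?F s) / ?e s) ` cbox (Complex p (-T)) (Complex q T))"
    by (intro compact_continuous_image continuous_intros continuous_on_subset[OF cont] compact_cbox)
       (auto simp: in_cbox_complex_iff)
  from compact_imp_bounded[OF this]
  obtain B2 where B2: "\<And>s. s \<in> cbox (Complex p (-T)) (Complex q T) \<Longrightarrow> cmod (?F s) / ?e s \<le> B2"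
    unfolding bounded_iff by fastforce
  have "cmod (?F s) \<le> max B1 B2 * ?e s" if s: "p \<le> Re s" "Re s \<le> q" for s
  proof (cases "T \<le> \<bar>Im s\<bar>")
    case True
    then have "cmod (?F s) \<le> B1 * ?e s" using s by (intro B1) auto
    also have "\<dots> \<le> max B1 B2 * ?e s" by (intro mult_right_mono) auto
    finally show ?thesis .
  next
    case False
    then have "s \<in> cbox (Complex p (-T)) (Complex q T)" using s by (auto simp: in_cbox_complex_iff)
    from B2[OF this] have "cmod (?F s) \<le> B2 * ?e s" by (simp add: field_simps)
    also have "\<dots> \<le> max B1 B2 * ?e s" by (intro mult_right_mono) auto
    finally show ?thesis .
  qed
  then show ?thesis using that by blast
qed


section \<open>Continuation of the moment function towards 0\<close>

text \<open>At a pole |F| tends to infinity along every approach, so one set accumulating at z is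
  enough to refute it.\<close>

lemma not_is_pole_if_bounded_near:
  assumes "z islimpt V" "\<And>w. w \<in> V \<Longrightarrow> cmod (F w) \<le> B"
  shows "\<not> is_pole F z"
proof
  assume "is_pole F z"
  then have "filterlim (\<lambda>w. cmod (F w)) at_top (at z)"
    unfolding is_pole_def by (rule filterlim_at_infinity_imp_norm_at_top)
  then have "eventually (\<lambda>w. B < cmod (F w)) (at z)"
    by (simp add: filterlim_at_top_dense)
  then have "eventually (\<lambda>w. w \<notin> V) (at z)"
    by eventually_elim (use assms(2) in force)
  then show False using assms(1) by (simp add: islimpt_iff_eventually)
qed

lemma of_real_islimpt_of_real_interval:
  assumes "p < x" "x < q"
  shows "complex_of_real x islimpt (of_real ` {p<..<q})"
  unfolding islimpt_approachable
proof (intro allI impI)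
  fix e :: real assume e: "e > 0"
  define y where "y = x + min (e / 2) ((q - x) / 2)"
  have "x < y" "y < q" "y - x < e" using assms e by (auto simp: y_def min_def field_simps)
  then show "\<exists>x'\<in>complex_of_real ` {p<..<q}. x' \<noteq> of_real x \<and> dist x' (of_real x) < e"
    using assms by (intro bexI[of _ "of_real y"]) (auto simp: dist_norm simp flip: of_real_diff)
qed

text \<open>Moving from x a small way towards an interior point c enters the open set at once, by
  convexity. The endpoints x = p and x = q are included since 0 will be one of them.\<close>

lemma real_islimpt_upper_half_strip:
  assumes "p < q" "p \<le> x" "x \<le> q"
  shows "complex_of_real x islimpt {z. p < Re z \<and> Re z < q \<and> Im z > 0}"
  unfolding islimpt_approachable
proof (intro allI impI)
  fix e :: real assume e: "e > 0"
  define c where "c = Complex ((p + q) / 2) 1"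
  define d where "d = min (1 / 2) (e / (2 * (1 + cmod (c - of_real x))))"
  have c: "1 + cmod (c - of_real x) > 0" by (simp add: add_pos_nonneg)
  have d: "0 < d" "d < 1" using e c by (auto simp: d_def)
  define z where "z = of_real x + of_real d * (c - of_real x)"
  have "d * cmod (c - of_real x) \<le> e / (2 * (1 + cmod (c - of_real x))) * (1 + cmod (c - of_real x))"
    using e c by (intro mult_mono) (auto simp: d_def)
  also have "e / (2 * n) * n = e / 2" if "n > 0" for n using that by simp
  from this[OF c] have "e / (2 * (1 + cmod (c - of_real x))) * (1 + cmod (c - of_real x)) = e / 2" .
  finally have "dist z (of_real x) < e" using e d by (simp add: z_def dist_norm norm_mult)
  moreover have "Im z > 0" using d by (simp add: z_def c_def)
  moreover have "p < Re z"
  proof -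
    have "(1 - d) * p + d * p < (1 - d) * x + d * ((p + q) / 2)"
      using assms d by (intro add_le_less_mono mult_left_mono mult_strict_left_mono) auto
    then show ?thesis by (simp add: z_def c_def algebra_simps)
  qed
  moreover have "Re z < q"
  proof -
    have "(1 - d) * x + d * ((p + q) / 2) < (1 - d) * q + d * q"
      using assms d by (intro add_le_less_mono mult_left_mono mult_strict_left_mono) auto
    then show ?thesis by (simp add: z_def c_def algebra_simps)
  qed
  ultimately show "\<exists>z\<in>{z. p < Re z \<and> Re z < q \<and> Im z > 0}. z \<noteq> of_real x \<and> dist z (of_real x) < e"
    by (intro bexI[of _ z]) auto
qed

text \<open>For fixed y the left side is monotone in x; the sum covers both signs of y and gives a
  single integrable majorant for a whole strip.\<close>

lemma exp_mult_le_endpoints: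
  fixes p q x y :: real
  assumes "p \<le> x" "x \<le> q"
  shows "exp (x * y) \<le> exp (p * y) + exp (q * y)"
proof (cases "y \<ge> 0")
  case True
  then have "exp (x * y) \<le> exp (q * y)" using assms by (auto intro: mult_right_mono)
  then show ?thesis by (simp add: add_increasing)
next
  case False
  then have "exp (x * y) \<le> exp (p * y)" using assms by (auto intro: mult_right_mono_neg)
  then show ?thesis by (simp add: add_increasing2)
qed

lemma holomorphic_on_exp_moment:
  fixes Y :: "'a \<Rightarrow> real"
  assumes [measurable]: "Y \<in> borel_measurable M"
    and int: "integrable M (\<lambda>\<omega>. exp (p * Y \<omega>))" "integrable M (\<lambda>\<omega>. exp (q * Y \<omega>))"
  shows "(\<lambda>s. CLINT \<omega>|M. exp (s * of_real (Y \<omega>))) holomorphic_on {s. p < Re s \<and> Re s < q}"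
proof (rule holomorphic_on_integral)
  show "open {s. p < Re s \<and> Re s < q}" by (rule open_vertical_strip)
  fix z assume z: "z \<in> {s. p < Re s \<and> Re s < q}"
  obtain r where r: "r > 0" "ball z r \<subseteq> {s. p < Re s \<and> Re s < q}"
    by (rule openE[OF open_vertical_strip z])
  have "cmod (exp (w * of_real (Y \<omega>))) \<le> exp (p * Y \<omega>) + exp (q * Y \<omega>)" if "w \<in> ball z r" for w \<omega>
    using exp_mult_le_endpoints[of p "Re w" q "Y \<omega>"] subsetD[OF r(2) that] by simp
  then show "\<exists>r>0. \<exists>g. integrable M g \<and>
      (\<forall>w\<in>ball z r. \<forall>\<omega>\<in>space M. cmod (exp (w * of_real (Y \<omega>))) \<le> g \<omega>)"
    using r(1) int by (intro exI[of _ r] conjI exI[of _ "\<lambda>\<omega>. exp (p * Y \<omega>) + exp (q * Y \<omega>)"]) auto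
qed (auto intro!: holomorphic_intros)

lemma integrable_exp_between:
  fixes Y :: "'a \<Rightarrow> real"
  assumes [measurable]: "Y \<in> borel_measurable M"
    and int: "integrable M (\<lambda>\<omega>. exp (p * Y \<omega>))" "integrable M (\<lambda>\<omega>. exp (q * Y \<omega>))"
    and "p \<le> x" "x \<le> q"
  shows "integrable M (\<lambda>\<omega>. exp (x * Y \<omega>))"
  by (rule Bochner_Integration.integrable_bound[OF Bochner_Integration.integrable_add[OF int]])
     (use exp_mult_le_endpoints[OF assms(4,5)] in \<open>auto intro!: order_trans[OF _ abs_ge_self]\<close>)

lemma norm_exp_moment_le:
  fixes Y :: "'a \<Rightarrow> real"
  assumes [measurable]: "Y \<in> borel_measurable M"
    and int: "integrable M (\<lambda>\<omega>. exp (p * Y \<omega>))" "integrable M (\<lambda>\<omega>. exp (q * Y \<omega>))"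
    and "p \<le> Re s" "Re s \<le> q"
  shows "cmod (CLINT \<omega>|M. exp (s * of_real (Y \<omega>))) \<le> (\<integral>\<omega>. exp (p * Y \<omega>) \<partial>M) + (\<integral>\<omega>. exp (q * Y \<omega>) \<partial>M)"
proof -
  have "cmod (CLINT \<omega>|M. exp (s * of_real (Y \<omega>))) \<le> (\<integral>\<omega>. exp (Re s * Y \<omega>) \<partial>M)"
    using integral_norm_bound[of M "\<lambda>\<omega>. exp (s * of_real (Y \<omega>))"] by simp
  also have "\<dots> \<le> (\<integral>\<omega>. exp (p * Y \<omega>) + exp (q * Y \<omega>) \<partial>M)"
    using exp_mult_le_endpoints[OF assms(4,5)] int
    by (intro integral_mono integrable_exp_between[OF _ int assms(4,5)]) auto
  also have "\<dots> = (\<integral>\<omega>. exp (p * Y \<omega>) \<partial>M) + (\<integral>\<omega>. exp (q * Y \<omega>) \<partial>M)"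
    using int by simp
  finally show ?thesis .
qed

text \<open>
  On the part above the real axis of the strip between \<open>0\<close> and a point \<open>x\<^sub>2\<close> of the moment interval,
  \<open>F\<close> equals the moment function by continuation, so it is bounded there.
\<close>

lemma (in prob_space) no_pole_between_zero_and_moment_interval:
  fixes Y :: "'a \<Rightarrow> real" and F :: "complex \<Rightarrow> complex"
  assumes Y[measurable]: "Y \<in> borel_measurable M"
    and int: "\<And>x. l < x \<Longrightarrow> x < u \<Longrightarrow> integrable M (\<lambda>\<omega>. exp (x * Y \<omega>))"
    and FL: "\<And>s. l < Re s \<Longrightarrow> Re s < u \<Longrightarrow> F s = (CLINT \<omega>|M. exp (s * of_real (Y \<omega>)))"
    and hol: "\<And>s. Im s \<noteq> 0 \<Longrightarrow> F analytic_on {s}"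
    and x2: "l < x2" "x2 < u" "x2 \<noteq> 0" and x: "min 0 x2 \<le> x" "x \<le> max 0 x2"
  shows "\<not> is_pole F (of_real x)"
proof -
  define p q where "p = min 0 x2" and "q = max 0 x2"
  have pq: "p < q" "p \<le> x" "x \<le> q" using x2 x by (auto simp: p_def q_def)
  \<comment> \<open>At the endpoint 0 the integrand is the constant 1, integrable for a probability
    measure.\<close>
  have intpq: "integrable M (\<lambda>\<omega>. exp (p * Y \<omega>))" "integrable M (\<lambda>\<omega>. exp (q * Y \<omega>))"
    using int[OF x2(1,2)] by (auto simp: p_def q_def min_def max_def)
  \<comment> \<open>V avoids the real axis, where F may still have poles at this stage, yet it is
    connected and accumulates at x.\<close>
  define V where "V = {z. p < Re z \<and> Re z < q \<and> Im z > 0}"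
  have V: "V = {z. p < Re z} \<inter> {z. Re z < q} \<inter> {z. Im z > 0}" by (auto simp: V_def)
  have oV: "open V" unfolding V
    by (intro open_Int open_halfspace_Re_gt open_halfspace_Re_lt open_halfspace_Im_gt)
  have cV: "convex V" unfolding V
    by (intro convex_Int convex_halfspace_Re_gt convex_halfspace_Re_lt convex_halfspace_Im_gt)
  define V' where "V' = V \<inter> {z. l < Re z} \<inter> {z. Re z < u}"
  have oV': "open V'" unfolding V'_def
    by (intro open_Int open_halfspace_Re_gt open_halfspace_Re_lt oV)
  \<comment> \<open>The identity theorem needs an overlap of V with the moment strip: y lies between
    0 and \<open>x2\<close>, near enough to \<open>x2\<close> to be in the moment interval.\<close>
  have "\<exists>y. p < y \<and> y < q \<and> l < y \<and> y < u"
  proof (cases "x2 > 0")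
    case True
    then show ?thesis using x2 by (intro exI[of _ "(max 0 l + x2) / 2"]) (auto simp: p_def q_def)
  next
    case False
    then show ?thesis using x2 by (intro exI[of _ "(min 0 u + x2) / 2"]) (auto simp: p_def q_def)
  qed
  then obtain y where "p < y" "y < q" "l < y" "y < u" by blast
  then have "Complex y 1 \<in> V'" by (simp add: V'_def V_def)
  then have ne: "V' \<noteq> {}" by blast
  have FV: "F z = (CLINT \<omega>|M. exp (z * of_real (Y \<omega>)))" if "z \<in> V" for z
  proof (rule analytic_continuation_open[OF oV' oV ne convex_connected[OF cV] _ _ _ _ that])
    show "F holomorphic_on V"
      by (rule analytic_imp_holomorphic) (subst analytic_on_analytic_at, use hol in \<open>auto simp: V_def\<close>)
    show "(\<lambda>z. CLINT \<omega>|M. exp (z * of_real (Y \<omega>))) holomorphic_on V"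
      by (rule holomorphic_on_subset[OF holomorphic_on_exp_moment[OF Y intpq]]) (auto simp: V_def)
  qed (auto simp: V'_def FL)
  show ?thesis
  proof (rule not_is_pole_if_bounded_near)
    show "of_real x islimpt V" unfolding V_def by (rule real_islimpt_upper_half_strip[OF pq])
    show "cmod (F w) \<le> (\<integral>\<omega>. exp (p * Y \<omega>) \<partial>M) + (\<integral>\<omega>. exp (q * Y \<omega>) \<partial>M)" if "w \<in> V" for w
      using that FV[OF that] norm_exp_moment_le[OF Y intpq, of w] by (simp add: V_def)
  qed
qed

text \<open>Identity theorem, started from the real segment around Re s.\<close>

lemma eq_exp_moment_on_strip:
  fixes Y :: "'a \<Rightarrow> real" and F :: "complex \<Rightarrow> complex"
  assumes Y: "Y \<in> borel_measurable M"
    and int: "\<And>x. l < x \<Longrightarrow> x < u \<Longrightarrow> integrable M (\<lambda>\<omega>. exp (x * Y \<omega>))"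
    and F: "\<And>x. l < x \<Longrightarrow> x < u \<Longrightarrow> F (of_real x) = of_real (\<integral>\<omega>. exp (x * Y \<omega>) \<partial>M)"
    and ana: "\<And>s. l < Re s \<Longrightarrow> Re s < u \<Longrightarrow> F analytic_on {s}"
    and s: "l < Re s" "Re s < u"
  shows "F s = (CLINT \<omega>|M. exp (s * of_real (Y \<omega>)))"
proof -
  \<comment> \<open>The strip is shrunk because holomorphy of the moment function uses integrability
    on both bounding abscissae, known only strictly between l and u.\<close>
  obtain p where p: "l < p" "p < Re s" using dense s(1) by blast
  obtain q where q: "Re s < q" "q < u" using dense s(2) by blast
  define S where "S = {s. p < Re s \<and> Re s < q}"
  have "F s - (CLINT \<omega>|M. exp (s * of_real (Y \<omega>))) = 0"
  proof (rule analytic_continuation[where f = "\<lambda>s. F s - (CLINT \<omega>|M. exp (s * of_real (Y \<omega>)))" and S = S and w = s and U = "of_real ` {p<..<q}" and \<xi> = "of_real (Re s)"])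
    have "F holomorphic_on S"
      by (rule analytic_imp_holomorphic) (subst analytic_on_analytic_at, use ana p q in \<open>auto simp: S_def\<close>)
    then show "(\<lambda>s. F s - (CLINT \<omega>|M. exp (s * of_real (Y \<omega>)))) holomorphic_on S"
      unfolding S_def using p q by (intro holomorphic_intros holomorphic_on_exp_moment Y int) auto
    show "open S" unfolding S_def by (rule open_vertical_strip)
    show "connected S" unfolding S_def by (rule convex_connected[OF convex_vertical_strip])
    show "complex_of_real (Re s) islimpt of_real ` {p<..<q}"
      by (rule of_real_islimpt_of_real_interval[OF p(2) q(1)])
    show "F z - (CLINT \<omega>|M. exp (z * of_real (Y \<omega>))) = 0" if "z \<in> of_real ` {p<..<q}" for z
    proof -
      obtain x where x: "z = of_real x" "p < x" "x < q" using \<open>z \<in> _\<close> by auto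
      have "(CLINT \<omega>|M. exp (z * of_real (Y \<omega>))) = (CLINT \<omega>|M. of_real (exp (x * Y \<omega>)))"
        by (intro Bochner_Integration.integral_cong refl) (simp add: x exp_of_real[symmetric])
      also have "\<dots> = of_real (\<integral>\<omega>. exp (x * Y \<omega>) \<partial>M)" by (rule integral_complex_of_real)
      finally show ?thesis using F[of x] x p q by simp
    qed
  qed (use p q in \<open>auto simp: S_def\<close>)
  then show ?thesis by simp
qed


section \<open>Smooth densities and the lines between the poles\<close>

lemma infinitely_differentiable_on_imp_continuous_on:
  assumes "infinitely_differentiable_on f S"
  shows "continuous_on S f"
proof (rule continuous_at_imp_continuous_on, rule ballI)
  fix x assume "x \<in> S"
  then have "(deriv ^^ 0) f differentiable (at x)"
    using assms unfolding infinitely_differentiable_on_def by blast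
  then show "isCont f x" by (simp add: differentiable_imp_continuous_within)
qed

text \<open>With complex w in place of y the integral defines a holomorphic H; the densities of Y
  and X are traces of H w and of H (Ln z) / z.\<close>

lemma infinitely_differentiable_line_densities:
  fixes f :: "real \<Rightarrow> real"
  assumes cont: "continuous_on UNIV (\<lambda>t. F (Complex \<sigma> t))"
    and bound: "\<And>t. cmod (F (Complex \<sigma> t)) \<le> C * exp (- \<kappa> * \<bar>t\<bar>)" and "\<kappa> > 0"
    and f: "\<And>y. of_real (f y) = 1 / (2 * of_real pi) * (CLINT t|lborel. exp (- of_real y * Complex \<sigma> t) * F (Complex \<sigma> t))"
  shows "infinitely_differentiable_on f UNIV"
    "infinitely_differentiable_on (\<lambda>x. if x > 0 then f (ln x) / x else 0) {0<..}"
proof -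
  define H where "H w = 1 / (2 * of_real pi) * (CLINT t|lborel. exp (- w * Complex \<sigma> t) * F (Complex \<sigma> t))" for w
  define U where "U = {w. \<bar>Im w\<bar> < \<kappa>}"
  have oU: "open U" unfolding U_def by (intro open_Collect_less continuous_intros)
  have H: "H holomorphic_on U"
    unfolding H_def[abs_def] U_def
    by (intro holomorphic_intros holomorphic_on_exp_line_integral[OF cont bound])
  have fH: "f y = Re (H (of_real y))" for y
  proof -
    have "complex_of_real (f y) = H (of_real y)" unfolding H_def by (rule f)
    then show ?thesis by (metis Re_complex_of_real)
  qed
  show "infinitely_differentiable_on f UNIV"
    by (rule infinitely_differentiable_on_Re_holomorphic[OF oU H]) (use fH \<open>\<kappa> > 0\<close> in \<open>auto simp: U_def\<close>)
  \<comment> \<open>The part of the right half-plane that \<open>Ln\<close> maps into the domain of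
    H; it contains the positive axis, where \<open>Ln\<close> is real.\<close>
  define V where "V = {z. Re z > 0} \<inter> Ln -` U"
  have nonpos: "z \<notin> \<real>\<^sub>\<le>\<^sub>0" if "Re z > 0" for z
    using that by (auto elim!: nonpos_Reals_cases)
  have "open V" unfolding V_def
    by (rule continuous_open_preimage) (use nonpos oU in \<open>auto intro!: continuous_intros open_halfspace_Re_gt\<close>)
  moreover have "(\<lambda>z. H (Ln z) / z) holomorphic_on V"
  proof (intro holomorphic_on_divide holomorphic_on_ident)
    have "(H \<circ> Ln) holomorphic_on V"
      by (rule holomorphic_on_compose_gen[OF _ H]) (use nonpos in \<open>auto simp: V_def intro!: holomorphic_intros\<close>)
    then show "(\<lambda>z. H (Ln z)) holomorphic_on V" by (simp add: o_def)
  qed (auto simp: V_def)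
  moreover have "(if x > 0 then f (ln x) / x else 0) = Re (H (Ln (of_real x)) / of_real x)" if "x \<in> {0<..}" for x
  proof -
    have "Ln (of_real x) = of_real (ln x)" using that by (simp add: Ln_of_real)
    then show ?thesis using that by (simp add: fH)
  qed
  ultimately show "infinitely_differentiable_on (\<lambda>x. if x > 0 then f (ln x) / x else 0) {0<..}"
    using \<open>\<kappa> > 0\<close>
    by (intro infinitely_differentiable_on_Re_holomorphic[of V]) (auto simp: V_def U_def Ln_of_real)
qed

text \<open>\<open>rho_plus\<close> and \<open>rho_minus\<close> see only the poles on their side of
  0, so 0 itself is a separate case.\<close>

lemma between_rho_no_pole:
  assumes "rho_minus F < ereal x" "ereal x < rho_plus F" "\<not> is_pole F 0"
  shows "\<not> is_pole F (of_real x)"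
proof
  assume pole: "is_pole F (of_real x)"
  consider "x = 0" | "x > 0" | "x < 0" by linarith
  then show False
  proof cases
    case 1 then show False using pole assms(3) by simp
  next
    case 2
    then have "rho_plus F \<le> ereal x" unfolding rho_plus_def using pole by (intro Inf_lower) auto
    then show False using assms(2) by simp
  next
    case 3
    then have "ereal x \<le> rho_minus F" unfolding rho_minus_def using pole by (intro Sup_upper) auto
    then show False using assms(1) by simp
  qed
qed

lemma rho_bounds:
  assumes "\<And>x. min 0 c \<le> x \<Longrightarrow> x \<le> max 0 c \<Longrightarrow> \<not> is_pole F (of_real x)"
  shows "rho_minus F \<le> ereal (min 0 c)" "ereal (max 0 c) \<le> rho_plus F"
proof -
  show "rho_minus F \<le> ereal (min 0 c)" unfolding rho_minus_def
  proof (rule Sup_least, safe)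
    fix x :: real assume "x < 0" "is_pole F (of_real x)"
    then have "\<not> min 0 c \<le> x" using assms[of x] by auto
    then show "ereal x \<le> ereal (min 0 c)" by auto
  qed
  show "ereal (max 0 c) \<le> rho_plus F" unfolding rho_plus_def
  proof (rule Inf_greatest, safe)
    fix x :: real assume "0 < x" "is_pole F (of_real x)"
    then have "\<not> x \<le> max 0 c" using assms[of x] by auto
    then show "ereal (max 0 c) \<le> ereal x" by auto
  qed
qed

text \<open>The segment from 0 to c will be free of poles, which gives only weak inequalities for
  \<open>rho_minus\<close> and \<open>rho_plus\<close>. They become strict at x, strictly between 0
  and c, and x still lies in the moment interval.\<close>

lemma exists_inner_nonzero_point:
  fixes l u :: real
  assumes "l < u"
  obtains c x where "l < c" "c < u" "c \<noteq> 0" "l < x" "x < u" "min 0 c \<le> x" "x \<le> max 0 c" "x \<noteq> c" "x \<noteq> 0"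
proof (cases "u > 0")
  case True
  define x where "x = (max l 0 + u) / 2"
  have "max l 0 < x" "x < u" using assms True by (auto simp: x_def)
  then show ?thesis using that[of "(x + u) / 2" x] by auto
next
  case False
  define x where "x = (l + u) / 2"
  have "l < x" "x < u" using assms by (auto simp: x_def)
  then show ?thesis using that[of "(l + x) / 2" x] False by auto
qed

theorem theorem5p4:
  fixes M :: "'a measure" and X Y :: "'a \<Rightarrow> real"
    and J K :: nat and C D \<gamma> :: real and a b a' b' :: "nat \<Rightarrow> real"
    and F :: "complex \<Rightarrow> complex"
  assumes "prob_space M"
    and "X \<in> borel_measurable M"
    and "AE \<omega> in M. X \<omega> > 0"
    and "has_gamma_type_moments M X J K C D a b a' b'"
    and "F = gamma_type_fun J K C D a b a' b'"
    and "Y = (\<lambda>\<omega>. ln (X \<omega>))"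
    and "\<gamma> = (\<Sum>j=1..J. \<bar>a j\<bar>) - (\<Sum>k=1..K. \<bar>a' k\<bar>)"
    and "\<gamma> > 0"
  shows "\<exists>f\<^sub>X f\<^sub>Y :: real \<Rightarrow> real.
    (\<forall>x. f\<^sub>X x \<ge> 0) \<and> (\<forall>y. f\<^sub>Y y \<ge> 0) \<and>
    distributed M lborel X (\<lambda>x. ennreal (f\<^sub>X x)) \<and>
    distributed M lborel Y (\<lambda>y. ennreal (f\<^sub>Y y)) \<and>
    continuous_on {0<..} f\<^sub>X \<and> infinitely_differentiable_on f\<^sub>X {0<..} \<and>
    continuous_on UNIV f\<^sub>Y \<and> infinitely_differentiable_on f\<^sub>Y UNIV \<and>
    (\<forall>\<sigma>. rho_minus F < ereal \<sigma> \<and> ereal \<sigma> < rho_plus F \<longrightarrow>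
      (\<forall>x>0. vline_integrable \<sigma> (\<lambda>s. of_real x powr (-s - 1) * F s) \<and>
         of_real (f\<^sub>X x) =
           1 / (2 * of_real pi * \<i>) * vline_integral \<sigma> (\<lambda>s. of_real x powr (-s - 1) * F s)) \<and>
      (\<forall>y. vline_integrable \<sigma> (\<lambda>s. exp (- of_real y * s) * F s) \<and>
         of_real (f\<^sub>Y y) =
           1 / (2 * of_real pi * \<i>) * vline_integral \<sigma> (\<lambda>s. exp (- of_real y * s) * F s)))"
proof -
  interpret prob_space M by fact
  note [measurable] = assms(2)
  define \<kappa> where "\<kappa> = pi * \<gamma> / 4"
  have \<kappa>: "\<kappa> > 0" using assms(8) by (simp add: \<kappa>_def)
  obtain l u where lu: "l < u" and D: "D > 0"
    and a: "\<forall>j\<in>{1..J}. a j \<noteq> 0" and a': "\<forall>k\<in>{1..K}. a' k \<noteq> 0"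
    and mom: "\<And>s. l < s \<Longrightarrow> s < u \<Longrightarrow> integrable M (\<lambda>\<omega>. X \<omega> powr s)"
      "\<And>s. l < s \<Longrightarrow> s < u \<Longrightarrow> of_real (\<integral>\<omega>. X \<omega> powr s \<partial>M) = F (of_real s)"
    using assms(4) unfolding has_gamma_type_moments_def assms(5) by auto
  have Y[measurable]: "Y \<in> borel_measurable M" unfolding assms(6) by measurable
  have XY: "AE \<omega> in M. X \<omega> = exp (Y \<omega>)" using assms(3) by eventually_elim (simp add: assms(6))
  \<comment> \<open>Only almost everywhere: at X = 0 the left side is 0 and the right side
    positive.\<close>
  have pw: "AE \<omega> in M. X \<omega> powr s = exp (s * Y \<omega>)" for s
    using assms(3) by eventually_elim (simp add: assms(6) powr_def)
  have int: "integrable M (\<lambda>\<omega>. exp (s * Y \<omega>))" if "l < s" "s < u" for s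
    using integrable_cong_AE[of "\<lambda>\<omega>. X \<omega> powr s" M "\<lambda>\<omega>. exp (s * Y \<omega>)"] pw[of s] mom(1)[OF that] by simp
  have Fmom: "F (of_real s) = of_real (\<integral>\<omega>. exp (s * Y \<omega>) \<partial>M)" if "l < s" "s < u" for s
    using integral_cong_AE[of "\<lambda>\<omega>. X \<omega> powr s" M "\<lambda>\<omega>. exp (s * Y \<omega>)"] pw[of s] mom(2)[OF that] by simp
  have ana: "F analytic_on {s}" if "\<not> is_pole F s" for s
    using nicely_meromorphic_on_imp_analytic_at[OF nicely_meromorphic_gamma_type_fun[OF D]] that
    unfolding assms(5) by blast
  have nonreal: "\<not> is_pole F s" if "Im s \<noteq> 0" for s
    using gamma_type_fun_pole_real[OF D a] that unfolding assms(5) by blast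
  \<comment> \<open>The value at a pole is 0, but in the moment interval F is the expectation of a
    positive variable.\<close>
  have nopole_lu: "\<not> is_pole F (of_real x)" if "l < x" "x < u" for x
  proof
    assume "is_pole F (of_real x)"
    then have "F (of_real x) = 0" unfolding assms(5) by (rule gamma_type_fun_pole_zero[OF D])
    then have "(\<integral>\<omega>. exp (x * Y \<omega>) \<partial>M) = 0" using Fmom[OF that] by simp
    then have "AE \<omega> in M. exp (x * Y \<omega>) = 0"
      using integral_nonneg_eq_0_iff_AE[OF int[OF that]] by simp
    then have "AE \<omega> in M. False" by simp
    then show False by simp
  qed
  have FL: "F s = (CLINT \<omega>|M. exp (s * of_real (Y \<omega>)))" if "l < Re s" "Re s < u" for s
  proof (rule eq_exp_moment_on_strip[OF Y int Fmom _ that])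
    fix s assume "l < Re s" "Re s < u"
    then show "F analytic_on {s}"
      using nonreal[of s] nopole_lu[of "Re s"] by (intro ana) (metis complex_is_Real_iff of_real_Re)
  qed
  obtain c x1 where c: "l < c" "c < u" "c \<noteq> 0" and x1: "l < x1" "x1 < u" "min 0 c \<le> x1" "x1 \<le> max 0 c" "x1 \<noteq> c" "x1 \<noteq> 0"
    using exists_inner_nonzero_point[OF lu] by metis
  have nopole_c: "\<not> is_pole F (of_real x)" if "min 0 c \<le> x" "x \<le> max 0 c" for x
    by (rule no_pole_between_zero_and_moment_interval[OF Y int FL ana[OF nonreal] c that])
  have nopole_0: "\<not> is_pole F 0" using nopole_c[of 0] by simp
  have \<rho>x1: "rho_minus F < ereal x1" "ereal x1 < rho_plus F"
  proof -
    have "min 0 c < x1" "x1 < max 0 c" using x1 c by (auto simp: min_def max_def split: if_splits)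
    then show "rho_minus F < ereal x1" "ereal x1 < rho_plus F"
      using le_less_trans[OF rho_bounds(1)[of c F, OF nopole_c]] less_le_trans[OF _ rho_bounds(2)[of c F, OF nopole_c]]
      by (simp_all only: less_ereal.simps(1))
  qed
  have anaS: "F analytic_on {s}" if "rho_minus F < ereal (Re s)" "ereal (Re s) < rho_plus F" for s
    using nonreal[of s] between_rho_no_pole[OF that nopole_0]
    by (intro ana) (metis complex_is_Real_iff of_real_Re)
  \<comment> \<open>The strip contains the target line and the line \<open>x1\<close>. Its closure
    stays between the poles, so F is continuous up to the boundary, as the compactness argument
    requires.\<close>
  have strip: "\<exists>p q B. p < \<sigma> \<and> p < x1 \<and> \<sigma> < q \<and> x1 < q \<and> F holomorphic_on {s. p < Re s \<and> Re s < q} \<and>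
      (\<forall>s. p < Re s \<longrightarrow> Re s < q \<longrightarrow> cmod (F s) \<le> B * exp (- \<kappa> * \<bar>Im s\<bar>))"
    if \<sigma>: "rho_minus F < ereal \<sigma>" "ereal \<sigma> < rho_plus F" for \<sigma>
  proof -
    have "rho_minus F < ereal (min \<sigma> x1)" "ereal (max \<sigma> x1) < rho_plus F"
      using \<sigma> \<rho>x1 by (auto simp: min_def max_def)
    note \<sigma>x1 = this
    obtain p where p: "rho_minus F < ereal p" "ereal p < ereal (min \<sigma> x1)"
      using ereal_dense2[OF \<sigma>x1(1)] by blast
    obtain q where q: "ereal (max \<sigma> x1) < ereal q" "ereal q < rho_plus F"
      using ereal_dense2[OF \<sigma>x1(2)] by blast
    have an: "F analytic_on {s. p \<le> Re s \<and> Re s \<le> q}"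
      unfolding analytic_on_analytic_at[of F "{s. p \<le> Re s \<and> Re s \<le> q}"]
    proof (safe intro!: anaS)
      fix s assume s: "p \<le> Re s" "Re s \<le> q"
      show "rho_minus F < ereal (Re s)" using p(1) s(1) by (auto elim: less_le_trans)
      show "ereal (Re s) < rho_plus F" using q(2) s(2) by (auto elim: le_less_trans[rotated])
    qed
    then have "continuous_on {s. p \<le> Re s \<and> Re s \<le> q} F"
      by (intro holomorphic_on_imp_continuous_on analytic_imp_holomorphic)
    then obtain B where "\<And>s. p \<le> Re s \<Longrightarrow> Re s \<le> q \<Longrightarrow> cmod (F s) \<le> B * exp (- \<kappa> * \<bar>Im s\<bar>)"
      using gamma_type_fun_strip_bound[OF D a a' assms(7,8), of p q C b b'] unfolding assms(5) \<kappa>_def by blast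
    moreover have "F holomorphic_on {s. p < Re s \<and> Re s < q}"
      by (rule holomorphic_on_subset[OF analytic_imp_holomorphic[OF an]]) auto
    ultimately show ?thesis using p q by (intro exI[of _ p] exI[of _ q] exI[of _ B]) auto
  qed
  have line: "\<exists>B. continuous_on UNIV (\<lambda>t. F (Complex \<sigma> t)) \<and> (\<forall>t. cmod (F (Complex \<sigma> t)) \<le> B * exp (- \<kappa> * \<bar>t\<bar>))"
    if \<sigma>: "rho_minus F < ereal \<sigma>" "ereal \<sigma> < rho_plus F" for \<sigma>
  proof -
    obtain p q B where pq: "p < \<sigma>" "\<sigma> < q" and hol: "F holomorphic_on {s. p < Re s \<and> Re s < q}"
      and B: "\<And>s. p < Re s \<Longrightarrow> Re s < q \<Longrightarrow> cmod (F s) \<le> B * exp (- \<kappa> * \<bar>Im s\<bar>)"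
      using strip[OF \<sigma>] by blast
    have "cmod (F (Complex \<sigma> t)) \<le> B * exp (- \<kappa> * \<bar>t\<bar>)" for t
      using B[of "Complex \<sigma> t"] pq by simp
    then show ?thesis using continuous_on_vertical_line[OF hol pq] by blast
  qed
  have integrable_line: "integrable lborel (\<lambda>t. exp (- of_real y * Complex \<sigma> t) * F (Complex \<sigma> t))"
    if \<sigma>: "rho_minus F < ereal \<sigma>" "ereal \<sigma> < rho_plus F" for \<sigma> y
    using line[OF \<sigma>] integrable_exp_line[of F \<sigma> _ \<kappa> "of_real y"] \<kappa> by auto
  have int_x1: "integrable lborel (\<lambda>t. F (Complex x1 t))"
    using integrable_line[OF \<rho>x1, of 0] by simp
  \<comment> \<open>On the line \<open>x1\<close> F is both the moment function and integrable, as
    inversion requires; on a general line between the poles only integrability is at hand.\<close>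
  obtain f where f: "\<And>y. f y \<ge> 0" "distributed M lborel Y (\<lambda>y. ennreal (f y))"
    "\<And>y. of_real (f y) = 1 / (2 * of_real pi) * (CLINT t|lborel. exp (- of_real y * Complex x1 t) * F (Complex x1 t))"
    using distributed_of_integrable_moment_line[OF Y int[OF x1(1,2)] _ int_x1] FL x1 by auto
  define g where "g x = (if x > 0 then f (ln x) / x else 0)" for x
  obtain B where "continuous_on UNIV (\<lambda>t. F (Complex x1 t))" "\<And>t. cmod (F (Complex x1 t)) \<le> B * exp (- \<kappa> * \<bar>t\<bar>)"
    using line[OF \<rho>x1] by blast
  from infinitely_differentiable_line_densities[OF this \<kappa> f(3)]
  have smooth: "infinitely_differentiable_on f UNIV" "infinitely_differentiable_on g {0<..}"
    by (simp_all add: g_def[abs_def])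
  have f_borel: "f \<in> borel_measurable borel"
    by (intro borel_measurable_continuous_onI infinitely_differentiable_on_imp_continuous_on smooth)
  have distX: "distributed M lborel X (\<lambda>x. ennreal (g x))"
    unfolding g_def by (rule distributed_exp[OF f(2,1) f_borel assms(2) XY])
  have shift: "of_real (f y) = 1 / (2 * of_real pi) * (CLINT t|lborel. exp (- of_real y * Complex \<sigma> t) * F (Complex \<sigma> t))"
    if \<sigma>: "rho_minus F < ereal \<sigma>" "ereal \<sigma> < rho_plus F" for \<sigma> y
  proof -
    obtain p q B where pq: "p < \<sigma>" "p < x1" "\<sigma> < q" "x1 < q"
      and hol: "F holomorphic_on {s. p < Re s \<and> Re s < q}"
      and B: "\<And>s. p < Re s \<Longrightarrow> Re s < q \<Longrightarrow> cmod (F s) \<le> B * exp (- \<kappa> * \<bar>Im s\<bar>)"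
      using strip[OF \<sigma>] by blast
    \<comment> \<open>For real y the factor exp (-y s) is bounded on the strip, so the full rate
      \<kappa> survives.\<close>
    have bd: "cmod (exp (- of_real y * s) * F s) \<le> exp (\<bar>y\<bar> * (\<bar>p\<bar> + \<bar>q\<bar>)) * B * exp (- \<kappa> * \<bar>Im s\<bar>)"
      if s: "p < Re s" "Re s < q" for s
    proof -
      have "- (y * Re s) \<le> \<bar>y\<bar> * \<bar>Re s\<bar>" by (metis abs_ge_minus_self abs_mult)
      also have "\<dots> \<le> \<bar>y\<bar> * (\<bar>p\<bar> + \<bar>q\<bar>)" using s by (intro mult_left_mono) auto
      finally have "cmod (exp (- of_real y * s)) \<le> exp (\<bar>y\<bar> * (\<bar>p\<bar> + \<bar>q\<bar>))" by simp
      then show ?thesis unfolding norm_mult mult.assoc by (intro mult_mono B s) auto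
    qed
    have "(CLINT t|lborel. exp (- of_real y * Complex x1 t) * F (Complex x1 t)) =
        (CLINT t|lborel. exp (- of_real y * Complex \<sigma> t) * F (Complex \<sigma> t))"
      by (rule vertical_line_integral_eq[where h = "\<lambda>s. exp (- of_real y * s) * F s", OF _ \<kappa> bd pq(2,4,1,3)])
         (auto intro!: holomorphic_intros hol)
    then show ?thesis using f(3) by simp
  qed
  have Yline: "vline_integrable \<sigma> (\<lambda>s. exp (- of_real y * s) * F s) \<and>
      of_real (f y) = 1 / (2 * of_real pi * \<i>) * vline_integral \<sigma> (\<lambda>s. exp (- of_real y * s) * F s)"
    if \<sigma>: "rho_minus F < ereal \<sigma>" "ereal \<sigma> < rho_plus F" for \<sigma> y
    unfolding vline_integrable_def vline_integral_def
  proof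
    show "integrable lborel (\<lambda>t. exp (- of_real y * Complex \<sigma> t) * F (Complex \<sigma> t) * \<i>)"
      by (rule integrable_mult_left[OF integrable_line[OF \<sigma>]])
    show "of_real (f y) = 1 / (2 * of_real pi * \<i>) * (CLINT t|lborel. exp (- of_real y * Complex \<sigma> t) * F (Complex \<sigma> t) * \<i>)"
      unfolding shift[OF \<sigma>] integral_mult_left_zero by (simp add: field_simps)
  qed
  have Xline: "vline_integrable \<sigma> (\<lambda>s. of_real x powr (- s - 1) * F s) \<and>
      of_real (g x) = 1 / (2 * of_real pi * \<i>) * vline_integral \<sigma> (\<lambda>s. of_real x powr (- s - 1) * F s)"
    if \<sigma>: "rho_minus F < ereal \<sigma>" "ereal \<sigma> < rho_plus F" and x: "x > 0" for \<sigma> x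
  proof -
    \<comment> \<open>With y = ln x the extra power of x is the factor 1 / x in g, so the formula
      for X reduces to that for Y.\<close>
    have eq: "of_real x powr (- s - 1) * F s = (1 / of_real x) * (exp (- of_real (ln x) * s) * F s)" for s
    proof -
      have "of_real x powr (- s - 1) = exp (- of_real (ln x) * s - of_real (ln x))"
        using x by (simp add: powr_def Ln_of_real algebra_simps)
      also have "\<dots> = exp (- of_real (ln x) * s) / of_real x"
        using x by (simp add: exp_diff exp_of_real)
      finally show ?thesis by simp
    qed
    note Y = Yline[OF \<sigma>, of "ln x", unfolded vline_integrable_def vline_integral_def]
    have "integrable lborel (\<lambda>t. (1 / of_real x) * (exp (- of_real (ln x) * Complex \<sigma> t) * F (Complex \<sigma> t) * \<i>))"
      by (rule integrable_mult_right[OF conjunct1[OF Y]])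
    moreover have "of_real (g x) = (1 / of_real x) * complex_of_real (f (ln x))" using x by (simp add: g_def)
    then have "of_real (g x) = 1 / (2 * of_real pi * \<i>) *
        ((1 / of_real x) * (CLINT t|lborel. exp (- of_real (ln x) * Complex \<sigma> t) * F (Complex \<sigma> t) * \<i>))"
      unfolding conjunct2[OF Y] by (simp add: mult_ac)
    ultimately show ?thesis
      unfolding vline_integrable_def vline_integral_def eq integral_mult_right_zero[symmetric] mult.assoc by blast
  qed
  have "\<forall>x. g x \<ge> 0" using f(1) by (simp add: g_def)
  moreover have "continuous_on {0<..} g" "continuous_on UNIV f"
    by (intro infinitely_differentiable_on_imp_continuous_on smooth)+
  ultimately show ?thesis
    using f(1,2) distX smooth Xline Yline by (intro exI[of _ g] exI[of _ f] conjI allI impI) blast+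
qed

end
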